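(* The algorithm SleepingMIS$(K)$ with $K=\lceil 3\log n\rceil$ described in the context is a randomized Monte Carlo distributed algorithm in the sleeping model which, on every $n$-node graph $G=(V,E)$, outputs a maximal independent set (MIS) of $G$ with high probability, and which has the following performance measures: (i) its expected node-averaged awake complexity is $O(1)$; (ii) its worst-case awake complexity is $O(\log n)$ (always); (iii) its node-averaged round complexity is $O(n^3)$ (always); (iv) its worst-case round complexity is $O(n^3)$ (always).
   Context: Conventions: $\log$ is base 2. "With high probability" means with probability at least $1-n^{-\gamma}$ for some constant $\gamma>1$. A Monte Carlo algorithm may produce an incorrect output with small probability. The constants in $O(\cdot)$ are absolute. Sleeping model. The network is an undirected graph $G=(V,E)$ with $n$ nodes. Nodes have unique IDs, know $n$, and have private randomness. Computation is in synchronous rounds; all nodes start in round 0 and know the current round number whenever awake. In each round each awake node may perform local computation and exchange (possibly distinct) $O(\log n)$-bit messages with its neighbors. A node may decide to sleep until a later round of its choice; a sleeping node neither sends nor receives messages (messages sent to it are lost) and does no computation. Complexity measures. Let $A_v$ be the number of rounds in which $v$ is awake before it finishes. The expected node-averaged awake complexity is $\mathrm{E}\big[\frac1n\sum_{v\in V}A_v\big]$, and the worst-case awake complexity is $\max_{v}A_v$. The worst-case round complexity is the number of rounds (awake and sleeping) until all nodes have finished; the node-averaged round complexity is the average over $v$ of the number of all rounds (awake and sleeping) until $v$ finishes. Algorithm SleepingMIS$(K)$. Each node $v$ sets a variable $v.\mathrm{inMIS}$ to unknown and draws independent fair random bits $v.X_1,\dots,v.X_K$. Then all nodes simultaneously call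 SleepingMISRecursive$(K)$. The output is the set of nodes with $\mathrm{inMIS}=$ true at the end. SleepingMISRecursive$(k)$, called simultaneously by all nodes of a set $U\subseteq V$ (all other nodes being asleep during the call, so that messages are exchanged exactly along the edges of the induced subgraph $G[U]$), is as follows for a node $v\in U$: 1. (Base case) If $k=0$: set $v.\mathrm{inMIS}$ to true and return (0 rounds). 2. (First isolated node detection, 1 round) Send a message to every neighbor; if $v$ receives no message (i.e. $v$ is isolated in $G[U]$), set $v.\mathrm{inMIS}$ to true. 3. (Left recursion) If $v.\mathrm{inMIS}=$ unknown and $v.X_k=1$, call SleepingMISRecursive$(k-1)$; otherwise sleep for $T(k-1)=3(2^{k-1}-1)$ rounds, the duration of that call. 4. (Synchronization/elimination step, 1 round) Send $v.\mathrm{inMIS}$ to every neighbor; if $v.\mathrm{inMIS}=$ unknown and $v$ receives a message from a neighbor $w$ with $w.\mathrm{inMIS}=$ true, set $v.\mathrm{inMIS}$ to false. 5. (Second isolated node detection, 1 round) Send $v.\mathrm{inMIS}$ to every neighbor; if $v.\mathrm{inMIS}=$ unknown and all messages received come from neighbors $w$ with $w.\mathrm{inMIS}=$ false, set $v.\mathrm{inMIS}$ to true. 6. (Right recursion) If $v.\mathrm{inMIS}=$ unknown, call SleepingMISRecursive$(k-1)$; otherwise sleep for $T(k-1)$ rounds. *)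

theory Defs
  imports "HOL-Probability.Probability" "HOL-Library.Monad_Syntax"
begin

text \<open>
  A finite simple undirected graph is a vertex set together with a symmetric, irreflexive adjacency
  relation.  Vertices are natural numbers (their unique IDs): every finite graph has such a copy, and
  a fixed infinite vertex type allows absolute constants to be quantified outside the graph.
\<close>

definition simple_graph :: "nat set \<Rightarrow> (nat \<times> nat) set \<Rightarrow> bool" where
  "simple_graph V E \<longleftrightarrow> finite V \<and> E \<subseteq> V \<times> V \<and> sym E \<and> irrefl E"

definition independent_set :: "nat set \<Rightarrow> (nat \<times> nat) set \<Rightarrow> nat set \<Rightarrow> bool" where
  "independent_set V E S \<longleftrightarrow> S \<subseteq> V \<and> (\<forall>u\<in>S. \<forall>v\<in>S. (u, v) \<notin> E)"

definition maximal_independent_set :: "nat set \<Rightarrow> (nat \<times> nat) set \<Rightarrow> nat set \<Rightarrow> bool" where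
  "maximal_independent_set V E S \<longleftrightarrow>
     independent_set V E S \<and> (\<forall>S'. independent_set V E S' \<and> S \<subseteq> S' \<longrightarrow> S' = S)"


type_synonym message = "bool list"

text \<open>
  The local program of a node, after its private random bits have been fixed.  \<open>Awake out k\<close> spends
  one round awake: the node sends \<open>out w\<close> to each neighbour \<open>w\<close> (\<open>None\<close>: no message) and continues
  with \<open>k inp\<close>, where \<open>inp w\<close> is the message received from \<open>w\<close> in that round.  \<open>Asleep p\<close> spends one
  round asleep; since \<open>p\<close> is fixed beforehand, nothing is computed or learnt in that round, and
  sleeping for a chosen number of rounds is an iteration of \<open>Asleep\<close>.  \<open>Finish x\<close> has terminated with
  output \<open>x\<close>.
\<close>

datatype 'a prog =
    Finish (result: 'a)
  | Awake "nat \<Rightarrow> message option" "(nat \<Rightarrow> message option) \<Rightarrow> 'a prog"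
  | Asleep "'a prog"

primrec bind_prog :: "'a prog \<Rightarrow> ('a \<Rightarrow> 'b prog) \<Rightarrow> 'b prog" where
  "bind_prog (Finish x) f = f x"
| "bind_prog (Awake out k) f = Awake out (\<lambda>inp. bind_prog (k inp) f)"
| "bind_prog (Asleep p) f = Asleep (bind_prog p f)"

adhoc_overloading Monad_Syntax.bind \<rightleftharpoons> bind_prog

definition broadcast :: "message \<Rightarrow> (nat \<Rightarrow> message option) prog" where
  "broadcast m = Awake (\<lambda>w. Some m) Finish"

definition sleep :: "nat \<Rightarrow> unit prog" where
  "sleep t = (Asleep ^^ t) (Finish ())"

text \<open>\<open>sent c u v\<close> is what \<open>u\<close> sends to \<open>v\<close> in a round that starts in the global configuration \<open>c\<close>.\<close>

definition sent :: "(nat \<Rightarrow> 'a prog) \<Rightarrow> nat \<Rightarrow> nat \<Rightarrow> message option" where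
  "sent c u v = (case c u of Awake out k \<Rightarrow> out v | _ \<Rightarrow> None)"

definition round_step :: "(nat \<times> nat) set \<Rightarrow> (nat \<Rightarrow> 'a prog) \<Rightarrow> nat \<Rightarrow> 'a prog" where
  "round_step E c v = (case c v of
       Finish x \<Rightarrow> Finish x
     | Awake out k \<Rightarrow> k (\<lambda>w. if (w, v) \<in> E then sent c w v else None)
     | Asleep p \<Rightarrow> p)"

text \<open>\<open>config E P t\<close> is the configuration at the start of round \<open>t\<close> when node \<open>v\<close> runs \<open>P v\<close>.\<close>

definition config :: "(nat \<times> nat) set \<Rightarrow> (nat \<Rightarrow> 'a prog) \<Rightarrow> nat \<Rightarrow> nat \<Rightarrow> 'a prog" where
  "config E P t = (round_step E ^^ t) P"

definition awake_rounds :: "(nat \<times> nat) set \<Rightarrow> (nat \<Rightarrow> 'a prog) \<Rightarrow> nat \<Rightarrow> nat" where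
  "awake_rounds E P v = card {t. \<exists>out k. config E P t v = Awake out k}"

definition finish_rounds :: "(nat \<times> nat) set \<Rightarrow> (nat \<Rightarrow> 'a prog) \<Rightarrow> nat \<Rightarrow> nat" where
  "finish_rounds E P v = (LEAST t. \<exists>x. config E P t v = Finish x)"

definition final_output :: "(nat \<times> nat) set \<Rightarrow> (nat \<Rightarrow> 'a prog) \<Rightarrow> nat \<Rightarrow> 'a" where
  "final_output E P v = result (config E P (finish_rounds E P v) v)"

text \<open>
  Programs are well-founded, so every node finishes and the previous three notions never
  refer to a non-terminating run.
\<close>

lemma config_Suc: "config E P (Suc t) v = round_step E (config E P t) v"
  by (simp add: config_def)

lemma config_add: "config E P (s + t) = config E (config E P s) t"
  unfolding config_def by (metis add.commute comp_apply funpow_add)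

lemma node_finishes: "\<exists>t x. config E P t v = Finish x"
proof -
  have "\<exists>t x. config E P t v = Finish x" if "P v = p" for p :: "'a prog" and P
    using that
  proof (induction p arbitrary: P)
    case (Finish x)
    then have "config E P 0 v = Finish x" by (simp add: config_def)
    then show ?case by blast
  next
    case (Awake out k)
    then have "config E P 1 v = k (\<lambda>w. if (w, v) \<in> E then sent P w v else None)"
      by (simp add: config_def round_step_def)
    then obtain t x where "config E (config E P 1) t v = Finish x"
      using Awake.IH by (metis rangeI)
    then show ?case by (metis config_add)
  next
    case (Asleep p)
    then have "config E P 1 v = p" by (simp add: config_def round_step_def)
    then obtain t x where "config E (config E P 1) t v = Finish x"
      using Asleep.IH by metis
    then show ?case by (metis config_add)
  qed
  then show ?thesis by blast
qed

lemma finished_stays: "config E P t v = Finish x \<Longrightarrow> config E P (t + s) v = Finish x"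
  by (induction s) (simp_all add: config_Suc round_step_def)

lemma finite_awake: "finite {t. \<exists>out k. config E P t v = Awake out k}"
proof -
  obtain t x where t: "config E P t v = Finish x" using node_finishes[of E P v] by blast
  have "{t. \<exists>out k. config E P t v = Awake out k} \<subseteq> {..<t}"
  proof
    fix s assume "s \<in> {t. \<exists>out k. config E P t v = Awake out k}"
    then have "config E P s v \<noteq> Finish x" by auto
    then show "s \<in> {..<t}" using finished_stays[OF t, of "s - t"] by (cases "t \<le> s") auto
  qed
  then show ?thesis using finite_subset by blast
qed

definition node_average :: "nat set \<Rightarrow> (nat \<Rightarrow> nat) \<Rightarrow> real" where
  "node_average V f = (\<Sum>v\<in>V. real (f v)) / real (card V)"

definition worst_case :: "nat set \<Rightarrow> (nat \<Rightarrow> nat) \<Rightarrow> real" where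
  "worst_case V f = real (Max (f ` V))"

definition messages_bounded :: "(nat \<times> nat) set \<Rightarrow> (nat \<Rightarrow> 'a prog) \<Rightarrow> real \<Rightarrow> bool" where
  "messages_bounded E P b \<longleftrightarrow>
     (\<forall>t u v m. (u, v) \<in> E \<longrightarrow> sent (config E P t) u v = Some m \<longrightarrow> real (length m) \<le> b)"


datatype status = Unknown | InMIS | NotInMIS

fun encode :: "status \<Rightarrow> message" where
  "encode Unknown = [False, False]"
| "encode InMIS = [True, True]"
| "encode NotInMIS = [True, False]"

definition call_duration :: "nat \<Rightarrow> nat" where
  "call_duration k = 3 * (2 ^ k - 1)"

text \<open>
  \<open>X i\<close> is the node's \<open>i\<close>-th random bit, and \<open>s\<close> the value of its variable \<open>inMIS\<close> at the time of
  the call; the value after the call is returned.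
\<close>

primrec sleeping_mis_rec :: "nat \<Rightarrow> (nat \<Rightarrow> bool) \<Rightarrow> status \<Rightarrow> status prog" where
  "sleeping_mis_rec 0 X s = Finish InMIS"
| "sleeping_mis_rec (Suc k) X s = do {
     inp \<leftarrow> broadcast [True];
     let s = (if \<forall>w. inp w = None then InMIS else s);
     s \<leftarrow> (if s = Unknown \<and> X (Suc k) then sleeping_mis_rec k X s
          else do { sleep (call_duration k); Finish s });
     inp \<leftarrow> broadcast (encode s);
     let s = (if s = Unknown \<and> (\<exists>w. inp w = Some (encode InMIS)) then NotInMIS else s);
     inp \<leftarrow> broadcast (encode s);
     let s = (if s = Unknown \<and> (\<forall>w m. inp w = Some m \<longrightarrow> m = encode NotInMIS) then InMIS else s);
     (if s = Unknown then sleeping_mis_rec k X s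
      else do { sleep (call_duration k); Finish s })
   }"

definition sleeping_mis :: "nat \<Rightarrow> (nat \<Rightarrow> bool) \<Rightarrow> status prog" where
  "sleeping_mis K X = sleeping_mis_rec K X Unknown"

definition recursion_depth :: "nat \<Rightarrow> nat" where
  "recursion_depth n = nat \<lceil>3 * log 2 (real n)\<rceil>"

text \<open>\<open>X v i\<close> is the \<open>i\<close>-th bit of node \<open>v\<close>.\<close>

definition random_bits :: "nat set \<Rightarrow> nat \<Rightarrow> (nat \<Rightarrow> nat \<Rightarrow> bool) pmf" where
  "random_bits V K =
     Pi_pmf V (\<lambda>_. False) (\<lambda>v. Pi_pmf {1..K} False (\<lambda>i. bernoulli_pmf (1/2)))"

definition mis_programs :: "nat \<Rightarrow> (nat \<Rightarrow> nat \<Rightarrow> bool) \<Rightarrow> nat \<Rightarrow> status prog" where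
  "mis_programs K X v = sleeping_mis K (X v)"

definition mis_output :: "nat set \<Rightarrow> (nat \<times> nat) set \<Rightarrow> (nat \<Rightarrow> status prog) \<Rightarrow> nat set" where
  "mis_output V E P = {v \<in> V. final_output E P v = InMIS}"

end

theory Submission
  imports Defs
begin

text \<open>
  A call on \<open>U\<close> always returns the greedy set for the order given by the unused bits, so the output is
  always dominating and fails to be independent only if it contains adjacent vertices with equal bits.
  Deferred decisions show that a vertex enters the right call with \<open>d\<close> surviving neighbours with
  probability at most \<open>2 ^ (-d - 1)\<close>.  Hence the left call has on average at most \<open>card U / 2\<close> vertices and
  the right one at most \<open>card U / 4\<close>, so the number of participations decays geometrically with the depth.
  Moreover the right call has on average at most \<open>card U / 4\<close> ordered edges even if \<open>U\<close> is dense, and a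
  given edge survives \<open>k\<close> more levels with probability at most \<open>2 ^ -k\<close>; summing along the left spine, about
  \<open>n K / 2 ^ K\<close> ties are expected, which is \<open>O(log n / n\<^sup>2)\<close>; the union bound
  over all edges would only give \<open>1 / n\<close>, short of the exponent greater than 1 that is required.
\<close>

subsection \<open>Averages over subsets\<close>

text \<open>The expectation of \<open>f\<close> at a uniformly random subset of \<open>A\<close>.
  The probabilistic argument is carried out with these finite sums;
  \<open>expectation_random_bits\<close> translates them to \<open>random_bits\<close>.\<close>

definition avg :: "'a set \<Rightarrow> ('a set \<Rightarrow> real) \<Rightarrow> real" where
  "avg A f = (\<Sum>S\<in>Pow A. f S) / 2 ^ card A"

lemma avg_cong: "(\<And>S. S \<subseteq> A \<Longrightarrow> f S = g S) \<Longrightarrow> avg A f = avg A g"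
  unfolding avg_def by (simp cong: sum.cong_simp)

lemma avg_mono: "(\<And>S. S \<subseteq> A \<Longrightarrow> f S \<le> g S) \<Longrightarrow> avg A f \<le> avg A g"
  unfolding avg_def by (intro divide_right_mono sum_mono) auto

lemma avg_add: "avg A (\<lambda>S. f S + g S) = avg A f + avg A g"
  by (simp add: avg_def sum.distrib add_divide_distrib)

lemma avg_cmult: "avg A (\<lambda>S. c * f S) = c * avg A f"
  by (simp add: avg_def sum_distrib_left)

lemma avg_sum: "avg A (\<lambda>S. \<Sum>i\<in>I. f i S) = (\<Sum>i\<in>I. avg A (f i))"
  unfolding avg_def by (subst sum.swap) (simp add: sum_divide_distrib)

lemma avg_const: "finite A \<Longrightarrow> avg A (\<lambda>_. c) = c"
  by (simp add: avg_def card_Pow)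

text \<open>Independence: a random subset of a disjoint union is a pair of independent random
  subsets.\<close>

lemma avg_Un:
  assumes "finite A" "finite B" "A \<inter> B = {}"
  shows "avg (A \<union> B) f = avg A (\<lambda>S. avg B (\<lambda>T. f (S \<union> T)))"
proof -
  have "(\<Sum>S\<in>Pow (A \<union> B). f S) = (\<Sum>(S, T)\<in>Pow A \<times> Pow B. f (S \<union> T))"
    using assms(3)
    by (intro sum.reindex_bij_witness[where j = "\<lambda>S. (S \<inter> A, S \<inter> B)" and i = "\<lambda>(S, T). S \<union> T"])
       (auto simp: Int_Un_distrib[symmetric] Int_absorb2 intro!: arg_cong[of _ _ f])
  then show ?thesis
    using assms by (simp add: avg_def card_Un_disjoint power_add sum.cartesian_product[symmetric]
        sum_divide_distrib mult.commute)
qed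

lemma avg_swap: "avg A (\<lambda>S. avg B (\<lambda>T. f S T)) = avg B (\<lambda>T. avg A (\<lambda>S. f S T))"
  unfolding avg_def by (simp add: sum_divide_distrib[symmetric]) (subst sum.swap, simp add: mult.commute)

text \<open>Coins outside \<open>A\<close> are integrated out; this discards the bits that a
  quantity does not read.\<close>

lemma avg_restrict:
  assumes "finite B" "A \<subseteq> B" "\<And>S. S \<subseteq> B \<Longrightarrow> f S = g (S \<inter> A)"
  shows "avg B f = avg A g"
proof -
  have "avg B f = avg (A \<union> (B - A)) f"
    using assms(2) by (simp add: Un_absorb1)
  also have "\<dots> = avg A (\<lambda>S. avg (B - A) (\<lambda>T. f (S \<union> T)))"
    using assms by (intro avg_Un) (auto intro: finite_subset)
  also have "\<dots> = avg A (\<lambda>S. avg (B - A) (\<lambda>T. g S))"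
  proof (intro avg_cong)
    fix S T assume "S \<subseteq> A" "T \<subseteq> B - A"
    moreover from this have "(S \<union> T) \<inter> A = S" by auto
    ultimately show "f (S \<union> T) = g S" using assms(2) assms(3)[of "S \<union> T"] by auto
  qed
  also have "\<dots> = avg A g" using assms(1) by (simp add: avg_const)
  finally show ?thesis .
qed

lemma avg_image:
  assumes "inj_on g A"
  shows "avg (g ` A) f = avg A (\<lambda>S. f (g ` S))"
proof -
  have "sum f (Pow (g ` A)) = sum f ((`) g ` Pow A)"
    by (simp add: image_Pow_surj)
  also have "\<dots> = (\<Sum>S\<in>Pow A. f (g ` S))"
    using assms by (simp add: sum.reindex inj_on_image_Pow)
  finally show ?thesis using assms by (simp add: avg_def card_image)
qed

lemma avg_superset:
  assumes "finite U" "A \<subseteq> U"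
  shows "avg U (\<lambda>T. of_bool (A \<subseteq> T)) = 1 / 2 ^ card A"
proof -
  have "avg U (\<lambda>T. of_bool (A \<subseteq> T)) = avg A (\<lambda>T. of_bool (A \<subseteq> T))"
    using assms by (intro avg_restrict) auto
  also have "\<dots> = avg A (\<lambda>T. of_bool (T = A))" by (intro avg_cong) auto
  also have "\<dots> = 1 / 2 ^ card A"
    using assms finite_subset[OF assms(2,1)] by (simp add: avg_def)
  finally show ?thesis .
qed

lemma avg_disjoint:
  assumes "finite U" "A \<subseteq> U"
  shows "avg U (\<lambda>T. of_bool (A \<inter> T = {})) = 1 / 2 ^ card A"
proof -
  have "avg U (\<lambda>T. of_bool (A \<inter> T = {})) = avg A (\<lambda>T. of_bool (A \<inter> T = {}))"
    using assms by (intro avg_restrict) (auto simp: Int_commute)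
  also have "\<dots> = avg A (\<lambda>T. of_bool (T = {}))" 
    by (intro avg_cong) (auto simp: Int_absorb1)
  also have "\<dots> = 1 / 2 ^ card A"
    using assms finite_subset[OF assms(2,1)] by (simp add: avg_def)
  finally show ?thesis .
qed

subsection \<open>The greedy set\<close>

text \<open>
  A set \<open>B\<close> of pairs encodes the random bits: the \<open>i\<close>-th bit of \<open>v\<close> is 1 iff \<open>(v, i) \<in> B\<close>.  The set
  \<open>greedy E B k U\<close> consists of the vertices of \<open>U\<close> without a neighbour in it of larger rank, where
  bits \<open>k, ..., 1\<close> form the rank; adjacent vertices of equal rank may both belong to it.
\<close>

definition ones :: "(nat \<times> nat) set \<Rightarrow> nat \<Rightarrow> nat set \<Rightarrow> nat set" where
  "ones B k U = {v \<in> U. (v, k) \<in> B}"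

definition nonisolated :: "(nat \<times> nat) set \<Rightarrow> nat set \<Rightarrow> nat set" where
  "nonisolated E U = U \<inter> E `` U"

text \<open>Ordered pairs: for symmetric, irreflexive \<open>E\<close> each undirected edge counts
  twice.\<close>

definition inner_edges :: "(nat \<times> nat) set \<Rightarrow> nat set \<Rightarrow> nat" where
  "inner_edges E U = card (E \<inter> U \<times> U)"

primrec greedy :: "(nat \<times> nat) set \<Rightarrow> (nat \<times> nat) set \<Rightarrow> nat \<Rightarrow> nat set \<Rightarrow> nat set" where
  "greedy E B 0 U = U"
| "greedy E B (Suc k) U = (let T = ones B (Suc k) U; A = greedy E B k T
     in A \<union> greedy E B k (U - T - E `` A))"

text \<open>\<open>T\<close> is a separate argument so that the top-level coins can be random while
  \<open>B\<close> fixes the order within \<open>T\<close>.\<close>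

definition residual :: "(nat \<times> nat) set \<Rightarrow> (nat \<times> nat) set \<Rightarrow> nat \<Rightarrow> nat set \<Rightarrow> nat set \<Rightarrow> nat set" where
  "residual E B k U T = U - T - E `` greedy E B k T"

definition left_call :: "(nat \<times> nat) set \<Rightarrow> (nat \<times> nat) set \<Rightarrow> nat \<Rightarrow> nat set \<Rightarrow> nat set" where
  "left_call E B k U = nonisolated E U \<inter> ones B (Suc k) U"

definition right_call :: "(nat \<times> nat) set \<Rightarrow> (nat \<times> nat) set \<Rightarrow> nat \<Rightarrow> nat set \<Rightarrow> nat set" where
  "right_call E B k U = nonisolated E (residual E B k U (ones B (Suc k) U))"

text \<open>Only calls of positive depth count, since the base case takes no round; each counted
  call costs a participant three awake rounds.\<close>

primrec calls :: "(nat \<times> nat) set \<Rightarrow> (nat \<times> nat) set \<Rightarrow> nat \<Rightarrow> nat set \<Rightarrow> nat \<Rightarrow> nat" where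
  "calls E B 0 U v = 0"
| "calls E B (Suc k) U v =
     of_bool (v \<in> U) + calls E B k (left_call E B k U) v + calls E B k (right_call E B k U) v"

lemma greedy_Suc:
  "greedy E B (Suc k) U = greedy E B k (ones B (Suc k) U) \<union>
     greedy E B k (residual E B k U (ones B (Suc k) U))"
  by (simp add: residual_def Let_def)

declare greedy.simps(2) [simp del]

lemma ones_subset: "ones B k U \<subseteq> U" by (auto simp: ones_def)

lemma residual_subset: "residual E B k U T \<subseteq> U - T" by (auto simp: residual_def)

lemma nonisolated_subset: "nonisolated E U \<subseteq> U" by (auto simp: nonisolated_def)

lemma left_call_subset: "left_call E B k U \<subseteq> U" 
  by (auto simp: left_call_def ones_def)

lemma right_call_subset: "right_call E B k U \<subseteq> U - ones B (Suc k) U"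
  by (auto simp: right_call_def nonisolated_def residual_def)

lemma greedy_subset: "greedy E B k U \<subseteq> U"
proof (induction k arbitrary: U)
  case (Suc k)
  show ?case
    unfolding greedy_Suc using Suc[of "ones B (Suc k) U"] ones_subset[of B "Suc k" U]
      Suc[of "residual E B k U (ones B (Suc k) U)"] residual_subset[of E B k U "ones B (Suc k) U"]
    by blast
qed simp

text \<open>An unchosen vertex is in the left part, dominated by its result, or in the residual;
  induction covers the first and the last case. Ties do no harm here, so only independence can
  fail.\<close>

lemma greedy_dominates: "v \<in> U - greedy E B k U \<Longrightarrow> v \<in> E `` greedy E B k U"
proof (induction k arbitrary: U)
  case (Suc k)
  let ?T = "ones B (Suc k) U"
  consider "v \<in> ?T" | "v \<in> E `` greedy E B k ?T" | "v \<in> residual E B k U ?T"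
    using Suc.prems by (auto simp: residual_def)
  then show ?case
    using Suc.prems Suc.IH[of ?T] Suc.IH[of "residual E B k U ?T"] unfolding greedy_Suc
    by cases auto
qed auto

text \<open>Vertices isolated in \<open>U\<close> are always chosen and dominate nothing in
  \<open>U\<close>, so detecting them early does not change the result. In the induction,
  \<open>I\<close> splits into its part in \<open>T\<close> and the part that passes into the
  residual.\<close>

lemma greedy_isolated:
  assumes "\<And>i u. i \<in> I \<Longrightarrow> u \<in> U \<Longrightarrow> (u, i) \<notin> E \<and> (i, u) \<notin> E" "I \<subseteq> U"
  shows "greedy E B k U = greedy E B k (U - I) \<union> I"
  using assms
proof (induction k arbitrary: U I)
  case (Suc k)
  define T where "T = ones B (Suc k) U"
  have T: "ones B (Suc k) (U - I) = T - I \<inter> T" by (auto simp: T_def ones_def)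
  have T': "greedy E B k T = greedy E B k (T - I \<inter> T) \<union> I \<inter> T"
    using Suc.prems ones_subset[of B "Suc k" U] by (intro Suc.IH) (auto simp: T_def)
  define D where "D = residual E B k U T"
  have "E `` (I \<inter> T) \<inter> U = {}" using Suc.prems by blast
  moreover have "I \<inter> E `` greedy E B k (T - I \<inter> T) = {}"
    using Suc.prems greedy_subset[of E B k "T - I \<inter> T"] ones_subset[of B "Suc k" U]
    unfolding T_def by blast
  ultimately have D: "residual E B k (U - I) (T - I \<inter> T) = D - (I - T)" "I - T \<subseteq> D"
    using T' Suc.prems(2) ones_subset[of B "Suc k" U] 
    unfolding D_def residual_def T_def by (auto simp: Image_Un)
  have D': "greedy E B k D = greedy E B k (D - (I - T)) \<union> (I - T)"
    using Suc.prems D(2) residual_subset[of E B k U T] by (intro Suc.IH) (auto simp: D_def)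
  show ?case unfolding greedy_Suc T using T' D' D(1) by (auto simp: D_def T_def)
qed auto

lemma greedy_nonisolated:
  assumes "sym E"
  shows "greedy E B k U = greedy E B k (nonisolated E U) \<union> (U - nonisolated E U)"
proof -
  have "greedy E B k U = greedy E B k (U - (U - nonisolated E U)) \<union> (U - nonisolated E U)"
    using assms by (intro greedy_isolated) (auto simp: nonisolated_def sym_def)
  then show ?thesis using nonisolated_subset[of E U] by (simp add: double_diff)
qed

text \<open>The first detection tests isolation in \<open>U\<close>, not in the left part, so a left
  call may contain vertices that are isolated within it.\<close>

lemma greedy_ones:
  assumes "sym E"
  shows "greedy E B k (ones B (Suc k) U) =
    greedy E B k (left_call E B k U) \<union> (ones B (Suc k) U - nonisolated E U)"
proof -
  let ?T = "ones B (Suc k) U"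
  have "greedy E B k ?T = greedy E B k (?T - (?T - nonisolated E U)) \<union> (?T - nonisolated E U)"
    using assms by (intro greedy_isolated) (auto simp: nonisolated_def sym_def ones_def)
  moreover have "?T - (?T - nonisolated E U) = left_call E B k U"
    by (auto simp: left_call_def)
  ultimately show ?thesis by simp
qed

text \<open>The four sets come from the left call, the first detection, the right call and the
  second detection. A vertex isolated in \<open>U\<close> with top bit 0 lies in both the second and
  the fourth.\<close>

lemma greedy_calls:
  assumes "sym E"
  shows "greedy E B (Suc k) U = greedy E B k (left_call E B k U) \<union> (U - nonisolated E U) \<union>
     greedy E B k (right_call E B k U) \<union>
     (residual E B k U (ones B (Suc k) U) - right_call E B k U)"
proof -
  let ?T = "ones B (Suc k) U"
  have "U - ?T - nonisolated E U \<subseteq> residual E B k U ?T - right_call E B k U"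
    using assms greedy_subset[of E B k ?T]
    by (auto simp: residual_def right_call_def nonisolated_def ones_def sym_def)
  then show ?thesis
    unfolding greedy_Suc greedy_ones[OF assms]
    using greedy_nonisolated[OF assms, of B k "residual E B k U ?T"]
    using ones_subset[of B "Suc k" U] by (auto simp: right_call_def)
qed

text \<open>Vertices settled by the first detection have no neighbours in \<open>U\<close>, so only
  the result of the left call eliminates anything.\<close>

lemma residual_left_call:
  assumes "sym E"
  shows "residual E B k U (ones B (Suc k) U) =
    U - ones B (Suc k) U - E `` greedy E B k (left_call E B k U)"
  using assms unfolding residual_def greedy_ones[OF assms]
  by (auto simp: nonisolated_def ones_def sym_def)

text \<open>Locality: bits of vertices outside \<open>U\<close> and bits above level
  \<open>k\<close> may be changed freely when averaging.\<close>

lemma greedy_cong: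
  assumes "\<And>v i. v \<in> U \<Longrightarrow> i \<in> {1..k} \<Longrightarrow> (v, i) \<in> B \<longleftrightarrow> (v, i) \<in> B'"
  shows "greedy E B k U = greedy E B' k U"
  using assms
proof (induction k arbitrary: U)
  case (Suc k)
  have T: "ones B (Suc k) U = ones B' (Suc k) U" using Suc.prems by (auto simp: ones_def)
  then have 1: "greedy E B k (ones B (Suc k) U) = greedy E B' k (ones B' (Suc k) U)"
    using Suc.prems by (auto simp: ones_def intro!: Suc.IH)
  then have D: "residual E B k U (ones B (Suc k) U) = residual E B' k U (ones B' (Suc k) U)"
    using T by (simp add: residual_def)
  have "greedy E B k (residual E B k U (ones B (Suc k) U)) =
      greedy E B' k (residual E B k U (ones B (Suc k) U))"
    using Suc.prems by (intro Suc.IH) (auto simp: residual_def)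
  then show ?case using 1 D by (simp add: greedy_Suc)
qed simp

lemma calls_cong:
  assumes "\<And>v i. v \<in> U \<Longrightarrow> i \<in> {1..k} \<Longrightarrow> (v, i) \<in> B \<longleftrightarrow> (v, i) \<in> B'"
  shows "calls E B k U v = calls E B' k U v"
  using assms
proof (induction k arbitrary: U)
  case (Suc k)
  have T: "ones B (Suc k) U = ones B' (Suc k) U" using Suc.prems by (auto simp: ones_def)
  have "greedy E B k (ones B (Suc k) U) = greedy E B' k (ones B (Suc k) U)"
    using Suc.prems by (intro greedy_cong) (auto simp: ones_def)
  then have LR: "left_call E B k U = left_call E B' k U" "right_call E B k U = right_call E B' k U"
    using T by (simp_all add: left_call_def right_call_def residual_def)
  have "calls E B k (left_call E B k U) v = calls E B' k (left_call E B k U) v"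
       "calls E B k (right_call E B k U) v = calls E B' k (right_call E B k U) v"
    using Suc.prems left_call_subset[of E B k U] right_call_subset[of E B k U]
    by (intro Suc.IH; force)+
  then show ?case using LR by simp
qed simp

text \<open>The two recursive calls have disjoint vertex sets, so a vertex takes part in at most one
  call per depth. This gives the worst-case awake bound.\<close>

lemma calls_le: "calls E B k U v \<le> k * of_bool (v \<in> U)"
proof (induction k arbitrary: U)
  case (Suc k)
  have "of_bool (v \<in> left_call E B k U) + of_bool (v \<in> right_call E B k U) \<le> (of_bool (v \<in> U) :: nat)"
    using left_call_subset[of E B k U] right_call_subset[of E B k U]
    by (auto simp: left_call_def)
  then have "k * of_bool (v \<in> left_call E B k U) + k * of_bool (v \<in> right_call E B k U)
      \<le> k * of_bool (v \<in> U)"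
    by (metis add_mult_distrib2 mult_le_mono2)
  then show ?case using Suc[of "left_call E B k U"] Suc[of "right_call E B k U"] by simp
qed simp

lemma inner_edges_mono: "finite U \<Longrightarrow> W \<subseteq> U \<Longrightarrow> inner_edges E W \<le> inner_edges E U"
  unfolding inner_edges_def by (intro card_mono) auto

text \<open>Ties arise only inside a recursive call: vertices isolated in \<open>U\<close> have no
  edges there, the residual avoids all neighbours of the left result, and an edge inside the
  residual has both ends in the right call.\<close>

lemma inner_edges_greedy_le:
  assumes "sym E" "finite U"
  shows "inner_edges E (greedy E B (Suc k) U) \<le>
    inner_edges E (greedy E B k (left_call E B k U)) + inner_edges E (greedy E B k (right_call E B k U))"
proof -
  let ?L = "greedy E B k (left_call E B k U)" and ?R = "greedy E B k (right_call E B k U)"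
  let ?D = "residual E B k U (ones B (Suc k) U)"
  have sub: "?L \<subseteq> U" "?R \<subseteq> ?D" "?D \<subseteq> U"
    using order_trans[OF greedy_subset left_call_subset]
      order_trans[OF greedy_subset nonisolated_subset, of E B k E ?D]
      order_trans[OF residual_subset Diff_subset] by (simp_all add: right_call_def)
  have fin: "finite ?L" "finite ?R" using sub assms(2) by (meson finite_subset order_trans)+
  have "x \<in> ?L \<and> y \<in> ?L \<or> x \<in> ?R \<and> y \<in> ?R"
    if xy: "(x, y) \<in> E" and x: "x \<in> greedy E B (Suc k) U" and y: "y \<in> greedy E B (Suc k) U" for x y
  proof -
    have yx: "(y, x) \<in> E" using assms(1) xy by (auto simp: sym_def)
    have "x \<in> U" "y \<in> U" using x y greedy_subset[of E B "Suc k" U] by blast+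
    then have "x \<in> nonisolated E U" "y \<in> nonisolated E U"
      using xy yx by (auto simp: nonisolated_def)
    then consider "x \<in> ?L" "y \<in> ?L" | "x \<in> ?L" "y \<in> ?D" | "x \<in> ?D" "y \<in> ?L" |
       "x \<in> ?D" "y \<in> ?D" using x y sub unfolding greedy_calls[OF assms(1)] by blast
    then show ?thesis
    proof cases
      case 4
      then have "x \<in> right_call E B k U" "y \<in> right_call E B k U"
        using xy yx by (auto simp: right_call_def nonisolated_def)
      then have "x \<notin> ?D - right_call E B k U" "y \<notin> ?D - right_call E B k U" by auto
      moreover have "x \<notin> ?L" "y \<notin> ?L"
        using 4 greedy_subset[of E B k "left_call E B k U"] residual_subset[of E B k U "ones B (Suc k) U"]
        by (auto simp: left_call_def)
      ultimately show ?thesis using x y \<open>x \<in> nonisolated E U\<close> \<open>y \<in> nonisolated E U\<close>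
        unfolding greedy_calls[OF assms(1)] by blast
    qed (use xy yx in \<open>auto simp: residual_left_call[OF assms(1)]\<close>)
  qed
  then have "E \<inter> greedy E B (Suc k) U \<times> greedy E B (Suc k) U \<subseteq> (E \<inter> ?L \<times> ?L) \<union> (E \<inter> ?R \<times> ?R)"
    by blast
  then have "inner_edges E (greedy E B (Suc k) U) \<le> card ((E \<inter> ?L \<times> ?L) \<union> (E \<inter> ?R \<times> ?R))"
    unfolding inner_edges_def using fin by (intro card_mono) auto
  also have "\<dots> \<le> inner_edges E ?L + inner_edges E ?R"
    unfolding inner_edges_def by (rule card_Un_le)
  finally show ?thesis .
qed

subsection \<open>Expected sizes of the recursive calls\<close>

text \<open>
  Deferred decisions: scan the vertices in greedy order, deciding membership of \<open>w\<close> in \<open>T\<close> only when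
  \<open>w\<close> is not yet dominated.  The weight that is doubled whenever a vertex of \<open>N\<close> turns out not to be in
  \<open>T\<close>, and set to 0 whenever one turns out to be in \<open>T\<close>, is a martingale; every vertex of
  \<open>N \<inter> residual E B k U T\<close> was decided.  The induction on \<open>k\<close> performs this scan.
\<close>

lemma avg_greedy_weight:
  assumes "finite U"
  shows "avg U (\<lambda>T. of_bool (N \<inter> greedy E B k T = {}) * 2 ^ card (N \<inter> residual E B k U T)) \<le> 1"
  using assms
proof (induction k arbitrary: U)
  case 0
  \<comment> \<open>At depth 0 the greedy set is \<open>T\<close> itself, which misses
    \<open>N \<inter> U\<close> with probability \<open>1 / 2 ^ card (N \<inter> U)\<close>; this
    cancels the largest possible weight.\<close>
  have "avg U (\<lambda>T. of_bool (N \<inter> greedy E B 0 T = {}) * 2 ^ card (N \<inter> residual E B 0 U T))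
      \<le> avg U (\<lambda>T. 2 ^ card (N \<inter> U) * of_bool ((N \<inter> U) \<inter> T = {}))"
    using 0 by (intro avg_mono) (auto simp: residual_def intro!: power_increasing card_mono)
  also have "\<dots> = 1"
    using avg_disjoint[OF 0, of "N \<inter> U"] by (simp add: avg_cmult)
  finally show ?case .
next
  case (Suc k)
  let ?w = "\<lambda>U T. of_bool (N \<inter> greedy E B k T = {}) * 2 ^ card (N \<inter> residual E B k U T) :: real"
  \<comment> \<open>The bits in \<open>B\<close> are fixed and only \<open>T\<close> is random. Its
    parts \<open>T1\<close> in \<open>U1\<close> and \<open>T0\<close> in \<open>U0\<close> are
    scanned in this order; \<open>W T1\<close> is what the first scan leaves undominated in
    \<open>U0\<close>.\<close>
  define U1 where "U1 = ones B (Suc k) U"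
  define U0 where "U0 = U - U1"
  define W where "W = (\<lambda>T1. U0 - E `` greedy E B k T1)"
  have fin: "finite U1" "finite U0" and Un: "U = U1 \<union> U0" "U1 \<inter> U0 = {}"
    using Suc.prems ones_subset[of B "Suc k" U] finite_subset by (auto simp: U1_def U0_def)
  have finW: "finite (W T1)" for T1 using fin by (simp add: W_def)
  \<comment> \<open>The indicator factorises, and the residual set is covered by those of the two
    scans, so the weight is at most the product.\<close>
  have step: "of_bool (N \<inter> greedy E B (Suc k) (T1 \<union> T0) = {}) *
      2 ^ card (N \<inter> residual E B (Suc k) U (T1 \<union> T0)) \<le> ?w U1 T1 * ?w (W T1) (T0 \<inter> W T1)"
    if "T1 \<subseteq> U1" "T0 \<subseteq> U0" for T1 T0
  proof -
    have T1: "ones B (Suc k) (T1 \<union> T0) = T1"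
      using that by (auto simp: U1_def U0_def ones_def)
    have T0: "residual E B k (T1 \<union> T0) T1 = T0 \<inter> W T1"
      using that Un(2) by (auto simp: residual_def W_def)
    have g: "greedy E B (Suc k) (T1 \<union> T0) = greedy E B k T1 \<union> greedy E B k (T0 \<inter> W T1)"
      by (simp add: greedy_Suc T1 T0)
    have "residual E B (Suc k) U (T1 \<union> T0) \<subseteq>
        residual E B k U1 T1 \<union> residual E B k (W T1) (T0 \<inter> W T1)"
      unfolding residual_def g Un W_def by auto
    then have "card (N \<inter> residual E B (Suc k) U (T1 \<union> T0)) \<le>
        card ((N \<inter> residual E B k U1 T1) \<union> (N \<inter> residual E B k (W T1) (T0 \<inter> W T1)))"
      using fin finW by (intro card_mono) (auto simp: residual_def)
    also have "\<dots> \<le> card (N \<inter> residual E B k U1 T1) + card (N \<inter> residual E B k (W T1) (T0 \<inter> W T1))"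
      by (rule card_Un_le)
    finally have "(2::real) ^ card (N \<inter> residual E B (Suc k) U (T1 \<union> T0)) \<le>
        2 ^ card (N \<inter> residual E B k U1 T1) * 2 ^ card (N \<inter> residual E B k (W T1) (T0 \<inter> W T1))"
      by (simp add: power_add[symmetric])
    then show ?thesis by (auto simp: g)
  qed
  \<comment> \<open>Given \<open>T1\<close>, only \<open>T0 \<inter> W T1\<close> matters, a
    uniformly random subset of \<open>W T1\<close>; the induction hypothesis for \<open>W T1\<close>
    bounds the second factor by 1 on average.\<close>
  have inner: "avg U0 (\<lambda>T0. ?w U1 T1 * ?w (W T1) (T0 \<inter> W T1)) \<le> ?w U1 T1" for T1
  proof -
    have "avg U0 (\<lambda>T0. ?w U1 T1 * ?w (W T1) (T0 \<inter> W T1)) =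
        ?w U1 T1 * avg U0 (\<lambda>T0. ?w (W T1) (T0 \<inter> W T1))"
      by (rule avg_cmult)
    also have "avg U0 (\<lambda>T0. ?w (W T1) (T0 \<inter> W T1)) = avg (W T1) (?w (W T1))"
      using fin by (intro avg_restrict) (auto simp: W_def)
    also have "?w U1 T1 * avg (W T1) (?w (W T1)) \<le> ?w U1 T1 * 1"
      using Suc.IH[OF finW] by (intro mult_left_mono) auto
    finally show ?thesis by simp
  qed
  have "avg U (\<lambda>T. of_bool (N \<inter> greedy E B (Suc k) T = {}) * 2 ^ card (N \<inter> residual E B (Suc k) U T))
     = avg U1 (\<lambda>T1. avg U0 (\<lambda>T0. of_bool (N \<inter> greedy E B (Suc k) (T1 \<union> T0) = {}) *
      2 ^ card (N \<inter> residual E B (Suc k) U (T1 \<union> T0))))"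
    by (subst Un(1), rule avg_Un) (use fin Un in auto)
  also have "\<dots> \<le> avg U1 (\<lambda>T1. avg U0 (\<lambda>T0. ?w U1 T1 * ?w (W T1) (T0 \<inter> W T1)))"
    by (intro avg_mono step)
  also have "\<dots> \<le> avg U1 (?w U1)"
    by (intro avg_mono inner)
  also have "\<dots> \<le> 1" by (rule Suc.IH[OF fin(1)])
  finally show ?case .
qed

text \<open>The coin of \<open>v\<close> gives the factor 1/2. If it keeps \<open>v\<close> out of
  \<open>T\<close>, then \<open>v\<close> survives exactly when no neighbour is chosen, the event in
  \<open>avg_greedy_weight\<close> for the neighbourhood of \<open>v\<close>.\<close>

lemma avg_residual_weight:
  assumes "finite U" "v \<in> U" "sym E" "irrefl E"
  shows "avg U (\<lambda>T. of_bool (v \<in> residual E B k U T) * 2 ^ card (E `` {v} \<inter> residual E B k U T)) \<le> 1/2"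
proof -
  let ?f = "\<lambda>T. of_bool (v \<in> residual E B k U T) * 2 ^ card (E `` {v} \<inter> residual E B k U T) :: real"
  let ?g = "\<lambda>T. of_bool (E `` {v} \<inter> greedy E B k T = {}) *
     2 ^ card (E `` {v} \<inter> residual E B k (U - {v}) T) :: real"
  have "avg U ?f = avg ((U - {v}) \<union> {v}) ?f" using assms(2) by (simp add: insert_absorb)
  also have "\<dots> = avg (U - {v}) (\<lambda>T. avg {v} (\<lambda>S. ?f (T \<union> S)))"
    using assms(1) by (intro avg_Un) auto
  also have "\<dots> = avg (U - {v}) (\<lambda>T. 1/2 * ?g T)"
  proof (intro avg_cong)
    fix T assume T: "T \<subseteq> U - {v}"
    have v: "v \<notin> E `` {v}" using assms(4) by (auto simp: irrefl_def)
    have 1: "v \<in> residual E B k U T \<longleftrightarrow> E `` {v} \<inter> greedy E B k T = {}"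
      using T assms(2,3) by (auto simp: residual_def sym_def)
    have 2: "E `` {v} \<inter> residual E B k U T = E `` {v} \<inter> residual E B k (U - {v}) T"
      using v by (auto simp: residual_def)
    have 3: "?f (insert v T) = 0" by (auto simp: residual_def)
    have "avg {v} (\<lambda>S. ?f (T \<union> S)) = (?f T + ?f (insert v T)) / 2"
      by (simp add: avg_def Pow_insert)
    then show "avg {v} (\<lambda>S. ?f (T \<union> S)) = 1/2 * ?g T"
      using 1 2 3 by simp
  qed
  also have "\<dots> \<le> 1/2"
    using avg_greedy_weight[of "U - {v}" "E `` {v}" E B k] assms(1) unfolding avg_cmult by simp
  finally show ?thesis .
qed

lemma inner_edges_eq_sum:
  assumes "finite U" "D \<subseteq> U"
  shows "inner_edges E D = (\<Sum>v\<in>U. of_bool (v \<in> D) * card (E `` {v} \<inter> D))"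
proof -
  have finD: "finite D" using assms finite_subset by blast
  have "E \<inter> D \<times> D = Sigma D (\<lambda>v. E `` {v} \<inter> D)" by auto
  then have "inner_edges E D = (\<Sum>v\<in>D. card (E `` {v} \<inter> D))"
    using finD by (simp add: inner_edges_def)
  also have "\<dots> = (\<Sum>v\<in>U. of_bool (v \<in> D) * card (E `` {v} \<inter> D))"
    using assms by (intro sum.mono_neutral_cong_left) auto
  finally show ?thesis .
qed

text \<open>Since \<open>d \<le> 2 ^ d / 2\<close>, the weight bound limits the expected residual
  degree of a vertex (0 if it does not survive) to 1/4, whatever its degree in
  \<open>U\<close>.\<close>

lemma avg_inner_edges_residual_le_card:
  assumes "finite U" "sym E" "irrefl E"
  shows "avg U (\<lambda>T. real (inner_edges E (residual E B k U T))) \<le> real (card U) / 4"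
proof -
  have deg: "real d \<le> 1/2 * 2 ^ d" for d :: nat
  proof (cases d)
    case (Suc m)
    have "real (Suc m) \<le> real (2 ^ m)" using less_exp[of m] unfolding of_nat_le_iff by (rule Suc_leI)
    then show ?thesis using Suc by simp
  qed simp
  have "avg U (\<lambda>T. real (inner_edges E (residual E B k U T))) =
     avg U (\<lambda>T. \<Sum>v\<in>U. of_bool (v \<in> residual E B k U T) * real (card (E `` {v} \<inter> residual E B k U T)))"
    using assms(1) residual_subset[of E B k U]
    by (intro avg_cong, subst inner_edges_eq_sum[of U]) auto
  also have "\<dots> = (\<Sum>v\<in>U. avg U (\<lambda>T. of_bool (v \<in> residual E B k U T) *
       real (card (E `` {v} \<inter> residual E B k U T))))"
    by (rule avg_sum)
  also have "\<dots> \<le> (\<Sum>v\<in>U. avg U (\<lambda>T. 1/2 * (of_bool (v \<in> residual E B k U T) *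
       2 ^ card (E `` {v} \<inter> residual E B k U T))))"
    using deg by (intro sum_mono avg_mono) auto
  also have "\<dots> \<le> (\<Sum>v\<in>U. 1/2 * (1/2))"
    unfolding avg_cmult using assms by (intro sum_mono mult_left_mono avg_residual_weight) auto
  finally show ?thesis by simp
qed

text \<open>An ordered edge survives only if its two distinct ends fall on the prescribed side of
  \<open>T\<close>, which has probability 1/4. \<open>P\<close> will be inclusion in
  \<open>T\<close> or disjointness from \<open>T\<close>.\<close>

lemma avg_inner_edges:
  assumes fin: "finite U" and irr: "irrefl E"
    and P: "\<And>A. A \<subseteq> U \<Longrightarrow> avg U (\<lambda>T. of_bool (P A T)) = 1 / 2 ^ card A"
    and D: "\<And>T u v. T \<subseteq> U \<Longrightarrow> u \<in> D T \<Longrightarrow> v \<in> D T \<Longrightarrow> u \<in> U \<and> v \<in> U \<and> P {u, v} T"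
  shows "avg U (\<lambda>T. real (inner_edges E (D T))) \<le> real (inner_edges E U) / 4"
proof -
  let ?M = "E \<inter> U \<times> U"
  have finM: "finite ?M" using fin by auto
  let ?P = "\<lambda>x T. P {fst x, snd x} T"
  have "avg U (\<lambda>T. real (inner_edges E (D T))) \<le> avg U (\<lambda>T. \<Sum>x\<in>?M. of_bool (?P x T))"
  proof (intro avg_mono)
    fix T assume "T \<subseteq> U"
    have "inner_edges E (D T) \<le> card (?M \<inter> {x. ?P x T})"
      unfolding inner_edges_def
    proof (rule card_mono)
      show "finite (?M \<inter> {x. ?P x T})" using finM by blast
      show "E \<inter> D T \<times> D T \<subseteq> ?M \<inter> {x. ?P x T}" using D[OF \<open>T \<subseteq> U\<close>] by auto
    qed
    then show "real (inner_edges E (D T)) \<le> (\<Sum>x\<in>?M. of_bool (?P x T))"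
      using finM by (simp add: sum_of_bool_eq)
  qed
  also have "\<dots> = (\<Sum>x\<in>?M. avg U (\<lambda>T. of_bool (?P x T)))"
    by (rule avg_sum)
  also have "\<dots> = (\<Sum>x\<in>?M. 1/4)"
  proof (intro sum.cong refl)
    fix x assume "x \<in> ?M"
    then have "{fst x, snd x} \<subseteq> U" "fst x \<noteq> snd x" using irr by (auto simp: irrefl_def)
    then show "avg U (\<lambda>T. of_bool (?P x T)) = 1/4"
      by (subst P) (auto simp: power2_eq_square)
  qed
  also have "\<dots> = real (inner_edges E U) / 4"
    by (simp add: inner_edges_def)
  finally show ?thesis .
qed

lemma avg_inner_edges_subset:
  assumes "finite U" "irrefl E"
  shows "avg U (\<lambda>T. real (inner_edges E (S \<inter> T))) \<le> real (inner_edges E U) / 4"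
  using assms by (intro avg_inner_edges[where P = "(\<subseteq>)"] avg_superset) auto

lemma avg_inner_edges_residual_le:
  assumes "finite U" "irrefl E"
  shows "avg U (\<lambda>T. real (inner_edges E (residual E B k U T))) \<le> real (inner_edges E U) / 4"
  using assms by (intro avg_inner_edges[where P = "\<lambda>A T. A \<inter> T = {}"] avg_disjoint)
    (auto simp: residual_def)

lemma avg_card_subset:
  assumes "finite U"
  shows "avg U (\<lambda>T. real (card (S \<inter> T))) \<le> real (card U) / 2"
proof -
  have "avg U (\<lambda>T. real (card (S \<inter> T))) \<le> avg U (\<lambda>T. \<Sum>v\<in>U. of_bool ({v} \<subseteq> T))"
  proof (intro avg_mono)
    fix T assume "T \<subseteq> U"
    then have "card (S \<inter> T) \<le> card (U \<inter> {v. {v} \<subseteq> T})"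
      using assms by (intro card_mono) auto
    then show "real (card (S \<inter> T)) \<le> (\<Sum>v\<in>U. of_bool ({v} \<subseteq> T))"
      using assms by (simp only: sum_of_bool_eq of_nat_le_iff)
  qed
  also have "\<dots> = (\<Sum>v\<in>U. avg U (\<lambda>T. of_bool ({v} \<subseteq> T)))" by (rule avg_sum)
  also have "\<dots> = (\<Sum>v\<in>U. 1/2)" using assms by (intro sum.cong refl, subst avg_superset) auto
  finally show ?thesis by simp
qed

lemma inner_edges_nonisolated_le: "finite U \<Longrightarrow> inner_edges E (nonisolated E U) \<le> inner_edges E U"
  by (intro inner_edges_mono nonisolated_subset)

lemma card_nonisolated_le:
  assumes "finite U"
  shows "card (nonisolated E U) \<le> inner_edges E U"
proof -
  have "nonisolated E U = snd ` (E \<inter> U \<times> U)" by (force simp: nonisolated_def)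
  then show ?thesis using assms by (simp add: inner_edges_def card_image_le)
qed

section \<open>Conditioning on the top level of bits\<close>

lemma avg_level:
  assumes "finite U"
  shows "avg (U \<times> {1..Suc k}) f = avg (U \<times> {1..k}) (\<lambda>B. avg U (\<lambda>T. f (B \<union> T \<times> {Suc k})))"
proof -
  have "U \<times> {1..Suc k} = U \<times> {1..k} \<union> (\<lambda>v. (v, Suc k)) ` U" by auto
  then have "avg (U \<times> {1..Suc k}) f =
      avg (U \<times> {1..k}) (\<lambda>B. avg ((\<lambda>v. (v, Suc k)) ` U) (\<lambda>S. f (B \<union> S)))"
    using assms by (simp only:) (rule avg_Un, auto)
  also have "\<dots> = avg (U \<times> {1..k}) (\<lambda>B. avg U (\<lambda>T. f (B \<union> T \<times> {Suc k})))"
    by (subst avg_image) (auto simp: inj_on_def image_def intro!: avg_cong arg_cong[of _ _ f])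
  finally show ?thesis .
qed

lemma calls_at_level:
  assumes "B \<subseteq> U \<times> {1..k}" "T \<subseteq> U"
  shows "left_call E (B \<union> T \<times> {Suc k}) k U = nonisolated E U \<inter> T"
    and "right_call E (B \<union> T \<times> {Suc k}) k U = nonisolated E (residual E B k U T)"
proof -
  have T: "ones (B \<union> T \<times> {Suc k}) (Suc k) U = T" using assms by (auto simp: ones_def)
  have "greedy E (B \<union> T \<times> {Suc k}) k T = greedy E B k T" by (rule greedy_cong) auto
  then show "left_call E (B \<union> T \<times> {Suc k}) k U = nonisolated E U \<inter> T"
    "right_call E (B \<union> T \<times> {Suc k}) k U = nonisolated E (residual E B k U T)"
    by (simp_all add: left_call_def right_call_def T residual_def)
qed

context
  fixes U :: "nat set" and E :: "(nat \<times> nat) set" and k :: nat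
    and F :: "nat set \<Rightarrow> (nat \<times> nat) set \<Rightarrow> real" and h :: "nat set \<Rightarrow> real"
  assumes fin: "finite U"
    and local: "\<And>W B B'. B \<inter> W \<times> {1..k} = B' \<inter> W \<times> {1..k} \<Longrightarrow> F W B = F W B'"
    and bound: "\<And>W. W \<subseteq> U \<Longrightarrow> avg (W \<times> {1..k}) (F W) \<le> h W"
begin

text \<open>\<open>F\<close> stands for a cost of a call on \<open>W\<close> that reads only bits of
  \<open>W\<close>. The vertex set of the left call depends on the top-level coins \<open>T\<close>
  alone, so bits 1 to \<open>k\<close> are still fresh and \<open>bound\<close> applies for each
  \<open>T\<close>.\<close>

lemma avg_left_call_le:
  "avg (U \<times> {1..Suc k}) (\<lambda>B. F (left_call E B k U) B) \<le> avg U (\<lambda>T. h (nonisolated E U \<inter> T))"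
proof -
  have "avg (U \<times> {1..Suc k}) (\<lambda>B. F (left_call E B k U) B) =
      avg U (\<lambda>T. avg (U \<times> {1..k}) (\<lambda>B. F (nonisolated E U \<inter> T) B))"
    unfolding avg_level[OF fin] 
    by (subst avg_swap, intro avg_cong) (simp add: calls_at_level, rule local, auto)
  also have "\<dots> = avg U (\<lambda>T. avg ((nonisolated E U \<inter> T) \<times> {1..k}) (F (nonisolated E U \<inter> T)))"
    using fin nonisolated_subset[of E U]
    by (intro avg_cong avg_restrict) (auto intro!: local)
  also have "\<dots> \<le> avg U (\<lambda>T. h (nonisolated E U \<inter> T))"
    using nonisolated_subset[of E U] by (intro avg_mono bound) auto
  finally show ?thesis .
qed

text \<open>The vertex set of the right call is determined by the bits of the vertices outside it.\<close>

lemma avg_right_call_le: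
  "avg (U \<times> {1..Suc k}) (\<lambda>B. F (right_call E B k U) B) \<le>
     avg (U \<times> {1..k}) (\<lambda>B. avg U (\<lambda>T. h (nonisolated E (residual E B k U T))))"
proof -
  let ?R = "\<lambda>B T. nonisolated E (residual E B k U T)"
  have *: "avg (U \<times> {1..k}) (\<lambda>B. F (?R B T) B) \<le> avg (U \<times> {1..k}) (\<lambda>B. h (?R B T))"
    if T: "T \<subseteq> U" for T
  proof -
    have fin': "finite (T \<times> {1..k})" "finite ((U - T) \<times> {1..k})"
      using T fin finite_subset by auto
    have split: "U \<times> {1..k} = T \<times> {1..k} \<union> (U - T) \<times> {1..k}"
      and disj: "T \<times> {1..k} \<inter> (U - T) \<times> {1..k} = {}" using T by auto
    have R: "?R (Y \<union> Z) T = ?R Y T" if "Z \<subseteq> (U - T) \<times> {1..k}" for Y Z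
    proof -
      have "greedy E (Y \<union> Z) k T = greedy E Y k T" using that by (intro greedy_cong) auto
      then show ?thesis by (simp add: residual_def)
    qed
    have sub: "?R Y T \<subseteq> U - T" for Y
      using nonisolated_subset residual_subset by (rule order_trans)
    \<comment> \<open>The bits \<open>Y\<close> of \<open>T\<close> determine the vertex set of the
      right call; by locality the call reads only bits from \<open>Z\<close>, which are independent
      of \<open>Y\<close>.\<close>
    have "avg (U \<times> {1..k}) (\<lambda>B. F (?R B T) B) =
        avg (T \<times> {1..k}) (\<lambda>Y. avg ((U - T) \<times> {1..k}) (\<lambda>Z. F (?R Y T) (Y \<union> Z)))"
      unfolding split avg_Un[OF fin' disj] by (intro avg_cong) (simp add: R)
    also have "\<dots> = avg (T \<times> {1..k}) (\<lambda>Y. avg (?R Y T \<times> {1..k}) (F (?R Y T)))"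
      using fin' sub by (intro avg_cong avg_restrict) (blast | rule local)+
    also have "\<dots> \<le> avg (T \<times> {1..k}) (\<lambda>Y. h (?R Y T))"
      using sub by (intro avg_mono bound) blast
    also have "\<dots> = avg (T \<times> {1..k}) (\<lambda>Y. avg ((U - T) \<times> {1..k}) (\<lambda>Z. h (?R (Y \<union> Z) T)))"
    proof (intro avg_cong)
      fix Y
      have "avg ((U - T) \<times> {1..k}) (\<lambda>Z. h (?R (Y \<union> Z) T)) = avg ((U - T) \<times> {1..k}) (\<lambda>Z. h (?R Y T))"
        by (intro avg_cong) (simp add: R)
      then show "h (?R Y T) = avg ((U - T) \<times> {1..k}) (\<lambda>Z. h (?R (Y \<union> Z) T))"
        using fin'(2) by (simp add: avg_const)
    qed
    also have "\<dots> = avg (U \<times> {1..k}) (\<lambda>B. h (?R B T))"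
      unfolding split avg_Un[OF fin' disj] ..
    finally show ?thesis .
  qed
  have "avg (U \<times> {1..Suc k}) (\<lambda>B. F (right_call E B k U) B) =
      avg U (\<lambda>T. avg (U \<times> {1..k}) (\<lambda>B. F (?R B T) B))"
    unfolding avg_level[OF fin]
    by (subst avg_swap, intro avg_cong) (simp add: calls_at_level, rule local, auto)
  also have "\<dots> \<le> avg U (\<lambda>T. avg (U \<times> {1..k}) (\<lambda>B. h (?R B T)))"
    by (intro avg_mono *)
  also have "\<dots> = avg (U \<times> {1..k}) (\<lambda>B. avg U (\<lambda>T. h (?R B T)))"
    by (rule avg_swap)
  finally show ?thesis .
qed

end

section \<open>Recurrences for the expected numbers of participations and of ties\<close>

lemma calls_eq_0: "v \<notin> U \<Longrightarrow> calls E B k U v = 0"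
  using calls_le[of E B k U v] by simp

text \<open>The constant 4 solves \<open>c = 1 + c/2 + c/4\<close>. The right call has on average at
  most a quarter of the vertices because each of them is an end of a residual ordered edge.\<close>

lemma avg_calls_le:
  assumes "finite U" "sym E" "irrefl E"
  shows "avg (U \<times> {1..k}) (\<lambda>B. \<Sum>v\<in>U. real (calls E B k U v)) \<le> 4 * real (card U)"
  using assms(1)
proof (induction k arbitrary: U)
  case 0
  then show ?case by (simp add: avg_def)
next
  case (Suc k)
  let ?F = "\<lambda>W B. \<Sum>v\<in>W. real (calls E B k W v)" and ?h = "\<lambda>W. 4 * real (card W)"
  have loc: "?F W B = ?F W B'" if "B \<inter> W \<times> {1..k} = B' \<inter> W \<times> {1..k}" for W B B'
    using that by (intro sum.cong refl arg_cong[of _ _ real] calls_cong) blast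
  have bound: "avg (W \<times> {1..k}) (?F W) \<le> ?h W" if "W \<subseteq> U" for W
    using Suc finite_subset[OF that] by blast
  have restrict: "(\<Sum>v\<in>U. real (calls E B k W v)) = ?F W B" if "W \<subseteq> U" for W B
    using that Suc.prems by (intro sum.mono_neutral_right) (auto simp: calls_eq_0)
  have "avg (U \<times> {1..Suc k}) (\<lambda>B. \<Sum>v\<in>U. real (calls E B (Suc k) U v)) =
      avg (U \<times> {1..Suc k}) (\<lambda>B. real (card U) + ?F (left_call E B k U) B + ?F (right_call E B k U) B)"
    by (intro avg_cong) (simp add: sum.distrib restrict[OF left_call_subset]
        restrict[OF order_trans[OF right_call_subset Diff_subset]])
  also have "\<dots> = real (card U) + avg (U \<times> {1..Suc k}) (\<lambda>B. ?F (left_call E B k U) B) +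
      avg (U \<times> {1..Suc k}) (\<lambda>B. ?F (right_call E B k U) B)"
    unfolding avg_add using Suc.prems by (simp add: avg_const)
  also have "avg (U \<times> {1..Suc k}) (\<lambda>B. ?F (left_call E B k U) B) \<le> 2 * real (card U)"
  proof -
    have "avg (U \<times> {1..Suc k}) (\<lambda>B. ?F (left_call E B k U) B) \<le> avg U (\<lambda>T. ?h (nonisolated E U \<inter> T))"
      by (rule avg_left_call_le[of U k ?F ?h, OF Suc.prems loc bound])
    also have "\<dots> \<le> 4 * (real (card U) / 2)"
      unfolding avg_cmult using Suc.prems by (intro mult_left_mono avg_card_subset) auto
    finally show ?thesis by simp
  qed
  also have "avg (U \<times> {1..Suc k}) (\<lambda>B. ?F (right_call E B k U) B) \<le> real (card U)"
  proof -
    have "avg (U \<times> {1..Suc k}) (\<lambda>B. ?F (right_call E B k U) B) \<le>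
        avg (U \<times> {1..k}) (\<lambda>B. avg U (\<lambda>T. ?h (nonisolated E (residual E B k U T))))"
      by (rule avg_right_call_le[of U k ?F ?h, OF Suc.prems loc bound])
    also have "\<dots> \<le> avg (U \<times> {1..k}) (\<lambda>B. real (card U))"
    proof (rule avg_mono)
      fix B
      have "avg U (\<lambda>T. ?h (nonisolated E (residual E B k U T))) \<le>
          avg U (\<lambda>T. 4 * real (inner_edges E (residual E B k U T)))"
        using Suc.prems by (intro avg_mono mult_left_mono) (auto intro: card_nonisolated_le simp: residual_def)
      also have "\<dots> \<le> 4 * (real (card U) / 4)"
        unfolding avg_cmult using Suc.prems assms by (intro mult_left_mono avg_inner_edges_residual_le_card) auto
      finally show "avg U (\<lambda>T. ?h (nonisolated E (residual E B k U T))) \<le> real (card U)" by simp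
    qed
    also have "\<dots> = real (card U)" using Suc.prems by (simp add: avg_const)
    finally show ?thesis .
  qed
  finally show ?case by simp
qed

text \<open>One level of the recursion, shared by the two tie bounds below. For the right call only
  the crude bound of edges over \<open>2 ^ k\<close> enters, so its share depends on the expected
  number of residual edges.\<close>

lemma avg_inner_edges_greedy_Suc_le:
  assumes "finite U" "sym E"
    and bound: "\<And>W. W \<subseteq> U \<Longrightarrow> avg (W \<times> {1..k}) (\<lambda>B. real (inner_edges E (greedy E B k W))) \<le> h W"
    and left: "avg U (\<lambda>T. h (nonisolated E U \<inter> T)) \<le> l"
    and right: "\<And>B. avg U (\<lambda>T. real (inner_edges E (residual E B k U T))) \<le> r"
    and h: "\<And>W. W \<subseteq> U \<Longrightarrow> h W \<le> real (inner_edges E W) / 2 ^ k"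
  shows "avg (U \<times> {1..Suc k}) (\<lambda>B. real (inner_edges E (greedy E B (Suc k) U))) \<le> l + r / 2 ^ k"
proof -
  let ?F = "\<lambda>W B. real (inner_edges E (greedy E B k W))"
  have loc: "?F W B = ?F W B'" if "B \<inter> W \<times> {1..k} = B' \<inter> W \<times> {1..k}" for W B B'
    using that by (intro arg_cong[of _ _ "\<lambda>W. real (inner_edges E W)"] greedy_cong) blast
  have "avg (U \<times> {1..Suc k}) (\<lambda>B. real (inner_edges E (greedy E B (Suc k) U))) \<le>
      avg (U \<times> {1..Suc k}) (\<lambda>B. ?F (left_call E B k U) B + ?F (right_call E B k U) B)"
    using inner_edges_greedy_le[OF assms(2,1)] by (intro avg_mono) (simp flip: of_nat_add)
  also have "\<dots> = avg (U \<times> {1..Suc k}) (\<lambda>B. ?F (left_call E B k U) B) +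
      avg (U \<times> {1..Suc k}) (\<lambda>B. ?F (right_call E B k U) B)"
    by (rule avg_add)
  also have "\<dots> \<le> l + r / 2 ^ k"
  proof (rule add_mono)
    show "avg (U \<times> {1..Suc k}) (\<lambda>B. ?F (left_call E B k U) B) \<le> l"
      using avg_left_call_le[of U k ?F h E, OF assms(1) loc bound] left by (rule order_trans)
    have "avg (U \<times> {1..Suc k}) (\<lambda>B. ?F (right_call E B k U) B) \<le>
        avg (U \<times> {1..k}) (\<lambda>B. avg U (\<lambda>T. h (nonisolated E (residual E B k U T))))"
      by (rule avg_right_call_le[of U k ?F h, OF assms(1) loc bound])
    also have "\<dots> \<le> avg (U \<times> {1..k}) (\<lambda>B. r / 2 ^ k)"
    proof (rule avg_mono)
      fix B
      have "avg U (\<lambda>T. h (nonisolated E (residual E B k U T))) \<le>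
          avg U (\<lambda>T. 1 / 2 ^ k * real (inner_edges E (residual E B k U T)))"
      proof (rule avg_mono)
        fix T
        let ?D = "residual E B k U T"
        have "?D \<subseteq> U" using residual_subset[of E B k U T] by blast
        then have "finite ?D" "nonisolated E ?D \<subseteq> U"
          using assms(1) nonisolated_subset[of E ?D] finite_subset by auto
        then have "h (nonisolated E ?D) \<le> real (inner_edges E (nonisolated E ?D)) / 2 ^ k"
          by (intro h)
        also have "\<dots> \<le> real (inner_edges E ?D) / 2 ^ k"
          using inner_edges_nonisolated_le[OF \<open>finite ?D\<close>] by (intro divide_right_mono) auto
        finally show "h (nonisolated E ?D) \<le> 1 / 2 ^ k * real (inner_edges E ?D)" by simp
      qed
      also have "\<dots> \<le> 1 / 2 ^ k * r"
        unfolding avg_cmult using right by (intro mult_left_mono) auto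
      finally show "avg U (\<lambda>T. h (nonisolated E (residual E B k U T))) \<le> r / 2 ^ k" by simp
    qed
    also have "\<dots> = r / 2 ^ k" using assms(1) by (simp add: avg_const)
    finally show "avg (U \<times> {1..Suc k}) (\<lambda>B. ?F (right_call E B k U) B) \<le> r / 2 ^ k" .
  qed
  finally show ?thesis .
qed

text \<open>Each of the two recursive calls keeps on average at most a quarter of the edges, so
  every level halves the bound.\<close>

lemma avg_inner_edges_greedy_le:
  assumes "finite U" "sym E" "irrefl E"
  shows "avg (U \<times> {1..k}) (\<lambda>B. real (inner_edges E (greedy E B k U))) \<le> real (inner_edges E U) / 2 ^ k"
  using assms(1)
proof (induction k arbitrary: U)
  case 0
  then show ?case by (simp add: avg_def)
next
  case (Suc k)
  have "avg (U \<times> {1..Suc k}) (\<lambda>B. real (inner_edges E (greedy E B (Suc k) U)))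
      \<le> real (inner_edges E U) / 4 / 2 ^ k + (real (inner_edges E U) / 4) / 2 ^ k"
  proof (rule avg_inner_edges_greedy_Suc_le[where h = "\<lambda>W. real (inner_edges E W) / 2 ^ k"])
    have "avg U (\<lambda>T. 1 / 2 ^ k * real (inner_edges E (nonisolated E U \<inter> T))) \<le>
        1 / 2 ^ k * (real (inner_edges E U) / 4)"
      unfolding avg_cmult using Suc.prems assms(3)
      by (intro mult_left_mono avg_inner_edges_subset) auto
    then show "avg U (\<lambda>T. real (inner_edges E (nonisolated E U \<inter> T)) / 2 ^ k) \<le>
        real (inner_edges E U) / 4 / 2 ^ k" by (simp add: mult.commute)
    show "avg U (\<lambda>T. real (inner_edges E (residual E B k U T))) \<le> real (inner_edges E U) / 4" for B
      using Suc.prems assms(3) by (rule avg_inner_edges_residual_le)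
    show "avg (W \<times> {1..k}) (\<lambda>B. real (inner_edges E (greedy E B k W))) \<le> real (inner_edges E W) / 2 ^ k"
      if "W \<subseteq> U" for W using Suc finite_subset[OF that] by blast
  qed (use Suc.prems assms in auto)
  then show ?case by simp
qed

text \<open>
  For dense graphs this improves the union bound by a factor of about \<open>card U / k\<close>: a left call keeps
  on average at most a quarter of the edges and half of the vertices, and a right call contains at most
  \<open>card U / 4\<close> edges on average, however dense \<open>U\<close> is.
\<close>

lemma avg_inner_edges_greedy_le_card:
  assumes "finite U" "sym E" "irrefl E"
  shows "avg (U \<times> {1..k}) (\<lambda>B. real (inner_edges E (greedy E B k U))) \<le>
    real k * real (card U) / 2 / 2 ^ k + real (inner_edges E U) / 4 ^ k"
  using assms(1)
proof (induction k arbitrary: U)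
  case 0
  then show ?case by (simp add: avg_def)
next
  case (Suc k)
  \<comment> \<open>The minimum carries both bounds at depth \<open>k\<close>: the left call uses
    the new one, the right call the one by edges alone.\<close>
  let ?h = "\<lambda>W. min (real (inner_edges E W) / 2 ^ k) (real k * real (card W) / 2 / 2 ^ k + real (inner_edges E W) / 4 ^ k)"
  have "avg (U \<times> {1..Suc k}) (\<lambda>B. real (inner_edges E (greedy E B (Suc k) U)))
      \<le> (real k * real (card U) / 4 / 2 ^ k + real (inner_edges E U) / 4 / 4 ^ k) + (real (card U) / 4) / 2 ^ k"
  proof (rule avg_inner_edges_greedy_Suc_le[where h = ?h])
    let ?W = "\<lambda>T. nonisolated E U \<inter> T"
    have "avg U (\<lambda>T. ?h (?W T)) \<le>
      avg U (\<lambda>T. (real k / 2 / 2 ^ k) * real (card (?W T)) + (1 / 4 ^ k) * real (inner_edges E (?W T)))"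
      by (intro avg_mono) auto
    also have "\<dots> \<le> (real k / 2 / 2 ^ k) * (real (card U) / 2) + (1 / 4 ^ k) * (real (inner_edges E U) / 4)"
      unfolding avg_add avg_cmult using Suc.prems assms(3)
      by (intro add_mono mult_left_mono avg_inner_edges_subset avg_card_subset) auto
    finally show "avg U (\<lambda>T. ?h (?W T)) \<le>
        real k * real (card U) / 4 / 2 ^ k + real (inner_edges E U) / 4 / 4 ^ k" by (simp add: mult.commute)
    show "avg U (\<lambda>T. real (inner_edges E (residual E B k U T))) \<le> real (card U) / 4" for B
      using Suc.prems assms(2,3) by (rule avg_inner_edges_residual_le_card)
    show "avg (W \<times> {1..k}) (\<lambda>B. real (inner_edges E (greedy E B k W))) \<le> ?h W"
      if "W \<subseteq> U" for W
      using Suc finite_subset[OF that] avg_inner_edges_greedy_le[OF _ assms(2,3)] by simp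
  qed (use Suc.prems assms in auto)
  also have "\<dots> = real (Suc k) * real (card U) / 2 / 2 ^ Suc k + real (inner_edges E U) / 4 ^ Suc k"
    by (simp add: field_simps)
  finally show ?case .
qed

subsection \<open>Averages as expectations over the random bits\<close>

text \<open>Fair coins make the product distribution uniform on the bit tables that are
  \<open>False\<close> outside \<open>V \<times> {1..K}\<close>; these are the characteristic
  functions of the sets \<open>B\<close>.\<close>

lemma random_bits_eq:
  assumes "finite V"
  shows "random_bits V K = map_pmf (\<lambda>B v i. (v, i) \<in> B) (pmf_of_set (Pow (V \<times> {1..K})))"
proof -
  let ?P = "PiE_dflt V (\<lambda>_. False) (\<lambda>_. PiE_dflt {1..K} False (\<lambda>_. UNIV))"
  have "random_bits V K = pmf_of_set ?P"
    unfolding random_bits_def bernoulli_pmf_half_conv_pmf_of_set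
    using assms by (subst Pi_pmf_of_set; simp add: finite_PiE_dflt)+
  also have "bij_betw (\<lambda>B v i. (v, i) \<in> B) (Pow (V \<times> {1..K})) ?P"
    by (rule bij_betw_byWitness[where f' = "\<lambda>X. {(v, i). X v i}"])
       (auto simp: PiE_dflt_def fun_eq_iff)
  then have "pmf_of_set ?P = map_pmf (\<lambda>B v i. (v, i) \<in> B) (pmf_of_set (Pow (V \<times> {1..K})))"
    using assms by (intro map_pmf_of_set_bij_betw[symmetric]) auto
  finally show ?thesis .
qed

lemma expectation_random_bits:
  fixes f :: "(nat \<Rightarrow> nat \<Rightarrow> bool) \<Rightarrow> real"
  assumes "finite V"
  shows "measure_pmf.expectation (random_bits V K) f = avg (V \<times> {1..K}) (\<lambda>B. f (\<lambda>v i. (v, i) \<in> B))"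
proof -
  have "finite (Pow (V \<times> {1..K}))" "Pow (V \<times> {1..K}) \<noteq> {}" using assms by auto
  then show ?thesis
    unfolding random_bits_eq[OF assms] using assms by (simp add: integral_pmf_of_set avg_def card_Pow)
qed

lemma prob_random_bits:
  assumes "finite V"
  shows "measure_pmf.prob (random_bits V K) {X. P X} = avg (V \<times> {1..K}) (\<lambda>B. of_bool (P (\<lambda>v i. (v, i) \<in> B)))"
proof -
  have "measure_pmf.prob (random_bits V K) {X. P X} =
      measure_pmf.expectation (random_bits V K) (indicator {X. P X})" by simp
  also have "\<dots> = avg (V \<times> {1..K}) (\<lambda>B. of_bool (P (\<lambda>v i. (v, i) \<in> B)))"
    unfolding expectation_random_bits[OF assms] by (intro avg_cong) (simp add: indicator_def)
  finally show ?thesis .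
qed

subsection \<open>Running the algorithm\<close>

text \<open>Unlike \<open>awake_rounds\<close> it stops before round \<open>t\<close>, so the counts
  of consecutive phases add up.\<close>

definition awake_count :: "(nat \<times> nat) set \<Rightarrow> (nat \<Rightarrow> 'a prog) \<Rightarrow> nat \<Rightarrow> nat \<Rightarrow> nat" where
  "awake_count E c t v = card {i. i < t \<and> (\<exists>out k. config E c i v = Awake out k)}"

lemma awake_count_0: "awake_count E c 0 v = 0"
  by (simp add: awake_count_def)

lemma awake_count_add: "awake_count E c (s + t) v = awake_count E c s v + awake_count E (config E c s) t v"
proof -
  let ?A = "\<lambda>c t. {i. i < t \<and> (\<exists>out k. config E c i v = Awake out k)}"
  have "?A c (s + t) = ?A c s \<union> (+) s ` ?A (config E c s) t"
  proof (intro equalityI subsetI)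
    fix i assume i: "i \<in> ?A c (s + t)"
    show "i \<in> ?A c s \<union> (+) s ` ?A (config E c s) t"
    proof (cases "i < s")
      case False
      then obtain j where j: "i = s + j" using le_Suc_ex by (metis not_less)
      then have "j \<in> ?A (config E c s) t" using i by (simp add: config_add)
      then show ?thesis using j by blast
    qed (use i in auto)
  qed (auto simp: config_add)
  then show ?thesis
    unfolding awake_count_def by (simp only:) (subst card_Un_disjoint, auto simp: card_image)
qed

lemma awake_count_1: "awake_count E c (Suc 0) v = of_bool (\<exists>out k. c v = Awake out k)"
proof -
  have "{i. i < Suc 0 \<and> (\<exists>out k. config E c i v = Awake out k)} =
      (if \<exists>out k. c v = Awake out k then {0} else {})" by (auto simp: config_def)
  then show ?thesis by (simp add: awake_count_def)
qed

lemma bind_prog_assoc: "bind_prog (bind_prog p f) g = bind_prog p (\<lambda>x. bind_prog (f x) g)"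
  by (induction p) auto

lemma bind_prog_broadcast: "bind_prog (broadcast m) f = Awake (\<lambda>w. Some m) f"
  by (simp add: broadcast_def)

lemma bind_prog_funpow_Asleep: "bind_prog ((Asleep ^^ t) p) f = (Asleep ^^ t) (bind_prog p f)"
  by (induction t) auto

lemma bind_prog_sleep: "bind_prog (sleep t) f = (Asleep ^^ t) (f ())"
  by (simp add: sleep_def bind_prog_funpow_Asleep)

lemma encode_inject: "encode s = encode s' \<longleftrightarrow> s = s'"
  by (cases s; cases s') auto

lemma call_duration_Suc: "call_duration (Suc k) = Suc (call_duration k + Suc (Suc (call_duration k)))"
proof -
  have "(1::nat) \<le> 2 ^ k" by simp
  then show ?thesis unfolding call_duration_def power_Suc by linarith
qed

text \<open>A call is cut at its three broadcasts and at the return of the left recursion;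
  \<open>f\<close> is what the node does after the call. These names describe the configuration at
  each phase boundary.\<close>

definition after_third :: "nat \<Rightarrow> (nat \<Rightarrow> bool) \<Rightarrow> (status \<Rightarrow> 'a prog) \<Rightarrow> status \<Rightarrow>
    (nat \<Rightarrow> message option) \<Rightarrow> 'a prog" where
  "after_third k X f s inp =
    (let s = (if s = Unknown \<and> (\<forall>w m. inp w = Some m \<longrightarrow> m = encode NotInMIS) then InMIS else s)
     in if s = Unknown then bind_prog (sleeping_mis_rec k X s) f
        else (Asleep ^^ call_duration k) (f s))"

definition after_second :: "nat \<Rightarrow> (nat \<Rightarrow> bool) \<Rightarrow> (status \<Rightarrow> 'a prog) \<Rightarrow> status \<Rightarrow>
    (nat \<Rightarrow> message option) \<Rightarrow> 'a prog" where
  "after_second k X f s inp =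
    (let s = (if s = Unknown \<and> (\<exists>w. inp w = Some (encode InMIS)) then NotInMIS else s)
     in Awake (\<lambda>w. Some (encode s)) (after_third k X f s))"

definition after_left :: "nat \<Rightarrow> (nat \<Rightarrow> bool) \<Rightarrow> (status \<Rightarrow> 'a prog) \<Rightarrow> status \<Rightarrow> 'a prog" where
  "after_left k X f s = Awake (\<lambda>w. Some (encode s)) (after_second k X f s)"

definition after_first :: "nat \<Rightarrow> (nat \<Rightarrow> bool) \<Rightarrow> (status \<Rightarrow> 'a prog) \<Rightarrow>
    (nat \<Rightarrow> message option) \<Rightarrow> 'a prog" where
  "after_first k X f inp =
    (let s = (if \<forall>w. inp w = None then InMIS else Unknown)
     in if s = Unknown \<and> X (Suc k) then bind_prog (sleeping_mis_rec k X s) (after_left k X f)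
        else (Asleep ^^ call_duration k) (after_left k X f s))"

lemma sleeping_mis_rec_Suc:
  "bind_prog (sleeping_mis_rec (Suc k) X Unknown) f = Awake (\<lambda>w. Some [True]) (after_first k X f)"
proof -
  have bind_if: "bind_prog (if P then p else q) g = (if P then bind_prog p g else bind_prog q g)"
    for P and p q :: "'b prog" and g :: "'b \<Rightarrow> 'c prog" by simp
  show ?thesis
    unfolding sleeping_mis_rec.simps after_first_def[abs_def] after_left_def[abs_def]
      after_second_def[abs_def] after_third_def[abs_def] Let_def bind_prog_assoc bind_prog_broadcast
      bind_if bind_prog_sleep
      bind_prog_funpow_Asleep bind_prog.simps by (rule refl)
qed

text \<open>Messages travel exactly along edges inside \<open>U\<close>: sleepers in
  \<open>V\<close> send nothing, and \<open>E \<subseteq> V \<times> V\<close> excludes senders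
  outside \<open>V\<close>, whose programs are unconstrained.\<close>

lemma round_step_broadcast:
  assumes "E \<subseteq> V \<times> V" "U \<subseteq> V" "v \<in> V"
    and "\<And>w. w \<in> U \<Longrightarrow> c w = Awake (\<lambda>_. Some (m w)) (h w)"
    and "\<And>w. w \<in> V - U \<Longrightarrow> c w = Asleep (q w)"
  shows "round_step E c v =
    (if v \<in> U then h v (\<lambda>w. if w \<in> U \<and> (w, v) \<in> E then Some (m w) else None) else q v)"
proof -
  have "(if (w, v) \<in> E then sent c w v else None) =
      (if w \<in> U \<and> (w, v) \<in> E then Some (m w) else None)" for w
    using assms(1) assms(4)[of w] assms(5)[of w] by (cases "w \<in> U") (auto simp: sent_def)
  then show ?thesis using assms(3-5) by (auto simp: round_step_def)
qed

text \<open>Simulation of one call. The continuation \<open>f\<close> and the values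
  \<open>s\<close> of the sleepers are arbitrary because the induction applies to the left and the
  right call, which return to different continuations.\<close>

lemma call_result:
  fixes f :: "nat \<Rightarrow> status \<Rightarrow> 'a prog"
  assumes "sym E" "E \<subseteq> V \<times> V" "U \<subseteq> V" "v \<in> V"
    and "\<And>v. v \<in> V \<Longrightarrow> c v =
      (if v \<in> U then bind_prog (sleeping_mis_rec k (X v) Unknown) (f v)
       else (Asleep ^^ call_duration k) (f v (s v)))"
  shows "config E c (call_duration k) v =
      f v (if v \<in> U then if v \<in> greedy E {(v, i). X v i} k U then InMIS else NotInMIS else s v)"
    and "awake_count E c (call_duration k) v = 3 * calls E {(v, i). X v i} k U v"
proof -
  have "config E c (call_duration k) v =
      f v (if v \<in> U then if v \<in> greedy E {(v, i). X v i} k U then InMIS else NotInMIS else s v) \<and>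
    awake_count E c (call_duration k) v = 3 * calls E {(v, i). X v i} k U v"
    using assms(3-)
  proof (induction k arbitrary: U c f s v)
    case 0
    then show ?case by (auto simp: call_duration_def config_def awake_count_0)
  next
    case (Suc k)
    let ?B = "{(v, i). X v i}" and ?d = "call_duration k"
    define L where "L = left_call E ?B k U"
    define R where "R = right_call E ?B k U"
    define D where "D = residual E ?B k U (ones ?B (Suc k) U)"
    define I where "I = U - nonisolated E U"
    define A where "A = greedy E ?B k L"
    have UV: "U \<subseteq> V" and v: "v \<in> V" by fact+
    have LU: "L \<subseteq> U" and RU: "R \<subseteq> U"
      using left_call_subset[of E ?B k U] right_call_subset[of E ?B k U] by (auto simp: L_def R_def)
    have D: "D = U - ones ?B (Suc k) U - E `` A"
      unfolding D_def A_def L_def by (rule residual_left_call[OF assms(1)])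
    have R: "R = D \<inter> E `` D" by (simp add: R_def D_def right_call_def nonisolated_def)
    have L: "L = {v \<in> U - I. X v (Suc k)}"
      by (auto simp: L_def I_def left_call_def ones_def nonisolated_def)
    have AL: "A \<subseteq> L" unfolding A_def by (rule greedy_subset)
    have gr: "greedy E ?B (Suc k) U = A \<union> I \<union> greedy E ?B k R \<union> (D - R)"
      using greedy_calls[OF assms(1), of ?B k U] by (simp add: A_def L_def R_def D_def I_def)
    have I: "(w, i) \<notin> E" "(i, w) \<notin> E" if "i \<in> I" "w \<in> U" for i w
      using that assms(1) by (auto simp: I_def nonisolated_def sym_def)
    \<comment> \<open>\<open>s1\<close> to \<open>s4\<close> are the values of \<open>inMIS\<close>
      on \<open>U\<close> after the first detection, the left call, the elimination and the second
      detection.\<close>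
    define s1 where "s1 v = (if v \<in> I then InMIS else Unknown)" for v
    define s2 where "s2 v = (if v \<in> L then if v \<in> A then InMIS else NotInMIS else s1 v)" for v
    define s3 where "s3 v = (if s2 v = Unknown \<and> (\<exists>w\<in>U. (w, v) \<in> E \<and> s2 w = InMIS)
      then NotInMIS else s2 v)" for v
    define s4 where "s4 v = (if s3 v = Unknown \<and> (\<forall>w\<in>U. (w, v) \<in> E \<longrightarrow> s3 w = NotInMIS)
      then InMIS else s3 v)" for v

    have s2_InMIS: "s2 w = InMIS \<longleftrightarrow> w \<in> A \<union> I" if "w \<in> U" for w
      using that AL L by (auto simp: s2_def s1_def)
    have s2_Unknown: "s2 w = Unknown \<longleftrightarrow> w \<in> U - I - ones ?B (Suc k) U" if "w \<in> U" for w
      using that L by (auto simp: s2_def s1_def ones_def)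
    have s3_Unknown: "s3 w = Unknown \<longleftrightarrow> w \<in> D - I" if w: "w \<in> U" for w
    proof -
      have "(\<exists>x\<in>U. (x, w) \<in> E \<and> s2 x = InMIS) \<longleftrightarrow> w \<in> E `` A"
        using I[OF _ w] AL LU by (auto simp: s2_InMIS)
      then show ?thesis using s2_Unknown[OF w] w by (auto simp: s3_def D)
    qed
    have s3_InMIS: "s3 w = InMIS \<longleftrightarrow> w \<in> A \<union> I" if "w \<in> U" for w
      using s2_InMIS[OF that] by (auto simp: s3_def)
    \<comment> \<open>A neighbour in \<open>U\<close> of a vertex of \<open>D\<close> is neither in
      \<open>A\<close> nor in \<open>I\<close>, so it is in \<open>D\<close> or already set to
      \<open>NotInMIS\<close>.\<close>
    have s4_cond: "(\<forall>x\<in>U. (x, w) \<in> E \<longrightarrow> s3 x = NotInMIS) \<longleftrightarrow> w \<notin> E `` D"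
      if w: "w \<in> D" for w
    proof -
      have "w \<in> U" using w by (simp add: D)
      have "s3 x = NotInMIS \<longleftrightarrow> x \<notin> D" if x: "x \<in> U" "(x, w) \<in> E" for x
      proof -
        have "x \<notin> I" "x \<notin> A" using x w I \<open>w \<in> U\<close> by (auto simp: D)
        then show ?thesis using s3_Unknown[OF x(1)] s3_InMIS[OF x(1)] by (cases "s3 x") auto
      qed
      then show ?thesis by (auto simp: D)
    qed
    have DI: "w \<notin> R" if "w \<in> I" for w using that I by (auto simp: R D)
    have s4_Unknown: "s4 w = Unknown \<longleftrightarrow> w \<in> R" if w: "w \<in> U" for w
      using s3_Unknown[OF w] s4_cond[of w] DI[of w] w by (auto simp: s4_def R)
    have s4_InMIS: "s4 w = InMIS \<longleftrightarrow> w \<in> A \<union> I \<union> (D - R)" if w: "w \<in> U" for w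
      using s3_Unknown[OF w] s3_InMIS[OF w] s4_cond[of w] w by (auto simp: s4_def R)

    define c1 where "c1 = config E c (Suc 0)"
    define c2 where "c2 = config E c1 ?d"
    define c3 where "c3 = config E c2 (Suc 0)"
    define c4 where "c4 = config E c3 (Suc 0)"
    have step: "config E c (Suc 0) = round_step E c" for c :: "nat \<Rightarrow> 'a prog"
      by (simp add: config_def)
    \<comment> \<open>The left call returns to \<open>g\<close>; nodes outside \<open>U\<close> then
      still sleep through two message rounds and the right recursion.\<close>
    define g where "g v x = (if v \<in> U then after_left k (X v) (f v) x
      else Asleep (Asleep ((Asleep ^^ ?d) (f v (s v)))))" for v x
    have c: "c w = (if w \<in> U then Awake (\<lambda>_. Some [True]) (after_first k (X w) (f w))
        else Asleep ((Asleep ^^ ?d) (Asleep (Asleep ((Asleep ^^ ?d) (f w (s w)))))))"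
      if "w \<in> V" for w
      using Suc.prems(3)[OF that]
      by (simp add: sleeping_mis_rec_Suc call_duration_Suc funpow_add funpow_swap1 del: sleeping_mis_rec.simps)
    have c1: "c1 w = (if w \<in> L then bind_prog (sleeping_mis_rec k (X w) Unknown) (g w)
        else (Asleep ^^ ?d) (g w (s1 w)))" if w: "w \<in> V" for w
    proof -
      have "c1 w = (if w \<in> U then after_first k (X w) (f w)
          (\<lambda>x. if x \<in> U \<and> (x, w) \<in> E then Some [True] else None)
          else (Asleep ^^ ?d) (Asleep (Asleep ((Asleep ^^ ?d) (f w (s w))))))"
        unfolding c1_def step using c UV
        by (intro round_step_broadcast[OF assms(2) UV w]) auto
      moreover have "(\<forall>x. (if x \<in> U \<and> (x, w) \<in> E then Some [True] else None) = None) \<longleftrightarrow> w \<in> I"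
        if "w \<in> U" using that by (auto simp: I_def nonisolated_def)
      ultimately show ?thesis
        by (auto simp: after_first_def g_def L s1_def fun_eq_iff[of "g w"] 
            intro!: arg_cong[of _ _ "bind_prog _"])
    qed
    have IH1: "c2 w = g w (s2 w)" "awake_count E c1 ?d w = 3 * calls E ?B k L w" if w: "w \<in> V" for w
      using Suc.IH[of L w c1 g s1, OF _ w c1] LU UV unfolding c2_def s2_def A_def by auto
    have c3: "c3 w = (if w \<in> U then Awake (\<lambda>_. Some (encode (s3 w))) (after_third k (X w) (f w) (s3 w))
        else Asleep ((Asleep ^^ ?d) (f w (s w))))" if w: "w \<in> V" for w
    proof -
      have "c3 w = (if w \<in> U then after_second k (X w) (f w) (s2 w)
          (\<lambda>x. if x \<in> U \<and> (x, w) \<in> E then Some (encode (s2 x)) else None)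
          else Asleep ((Asleep ^^ ?d) (f w (s w))))"
        unfolding c3_def step using IH1(1) UV
        by (intro round_step_broadcast[OF assms(2) UV w]) (auto simp: g_def after_left_def)
      moreover have "(\<exists>x. (if x \<in> U \<and> (x, w) \<in> E then Some (encode (s2 x)) else None) = Some (encode InMIS))
         \<longleftrightarrow> (\<exists>x\<in>U. (x, w) \<in> E \<and> s2 x = InMIS)"
        by (auto simp: encode_inject simp del: encode.simps split: if_splits)
      ultimately show ?thesis by (simp only: after_second_def Let_def s3_def)
    qed
    have c4: "c4 w = (if w \<in> R then bind_prog (sleeping_mis_rec k (X w) Unknown) (f w)
        else (Asleep ^^ ?d) (f w (if w \<in> U then s4 w else s w)))" if w: "w \<in> V" for w
    proof -
      have "c4 w = (if w \<in> U then after_third k (X w) (f w) (s3 w)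
          (\<lambda>x. if x \<in> U \<and> (x, w) \<in> E then Some (encode (s3 x)) else None)
          else (Asleep ^^ ?d) (f w (s w)))"
        unfolding c4_def step using c3 UV
        by (intro round_step_broadcast[OF assms(2) UV w]) auto
      moreover have "(\<forall>x m. (if x \<in> U \<and> (x, w) \<in> E then Some (encode (s3 x)) else None) = Some m
           \<longrightarrow> m = encode NotInMIS) \<longleftrightarrow> (\<forall>x\<in>U. (x, w) \<in> E \<longrightarrow> s3 x = NotInMIS)"
        by (auto simp: encode_inject simp del: encode.simps split: if_splits)
      ultimately have "c4 w = (if w \<in> U then if s4 w = Unknown
            then bind_prog (sleeping_mis_rec k (X w) (s4 w)) (f w)
            else (Asleep ^^ call_duration k) (f w (s4 w))
          else (Asleep ^^ ?d) (f w (s w)))"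
        by (simp only: after_third_def Let_def s4_def)
      then show ?thesis using s4_Unknown[of w] RU by auto
    qed
    have IH2: "config E c4 ?d w = f w (if w \<in> R then if w \<in> greedy E ?B k R then InMIS else NotInMIS
          else if w \<in> U then s4 w else s w)"
      "awake_count E c4 ?d w = 3 * calls E ?B k R w" if w: "w \<in> V" for w
      using Suc.IH[of R w c4 f "\<lambda>w. if w \<in> U then s4 w else s w", OF _ w c4] RU UV by auto

    have "config E c (call_duration (Suc k)) =  config E c4 ?d"
      unfolding c4_def c3_def c2_def c1_def config_add[symmetric] by (simp add: call_duration_Suc)
    moreover have "(if v \<in> R then if v \<in> greedy E ?B k R then InMIS else NotInMIS else s4 v) =
        (if v \<in> greedy E ?B (Suc k) U then InMIS else NotInMIS)" if "v \<in> U"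
      using s4_InMIS[OF that] s4_Unknown[OF that] greedy_subset[of E ?B k R] DI[of v] AL LU
      unfolding gr by (cases "s4 v") (auto simp: R D L ones_def)
    ultimately have "config E c (call_duration (Suc k)) v = f v (if v \<in> U then
        if v \<in> greedy E ?B (Suc k) U then InMIS else NotInMIS else s v)"
      using IH2(1)[OF v] RU by auto
    moreover have "awake_count E c (call_duration (Suc k)) v = 3 * calls E ?B (Suc k) U v"
    proof -
      \<comment> \<open>A round, the left call, two rounds and the right call; of \<open>V\<close>,
        exactly the nodes of \<open>U\<close> are awake in the three single rounds.\<close>
      have "call_duration (Suc k) = Suc 0 + (?d + (Suc 0 + (Suc 0 + ?d)))"
        by (simp add: call_duration_Suc)
      then have "awake_count E c (call_duration (Suc k)) v = awake_count E c (Suc 0) v +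
          (awake_count E c1 ?d v + (awake_count E c2 (Suc 0) v + (awake_count E c3 (Suc 0) v +
           awake_count E c4 ?d v)))"
        by (simp only: awake_count_add c1_def c2_def c3_def c4_def)
      also have "\<dots> = 3 * calls E ?B (Suc k) U v"
        using IH1[OF v] IH2(2)[OF v] c[OF v] c3[OF v]
        by (simp add: awake_count_1 L_def R_def g_def after_left_def)
      finally show ?thesis .
    qed
    ultimately show ?case ..
  qed
  then show "config E c (call_duration k) v =
      f v (if v \<in> U then if v \<in> greedy E {(v, i). X v i} k U then InMIS else NotInMIS else s v)"
    and "awake_count E c (call_duration k) v = 3 * calls E {(v, i). X v i} k U v" by blast+
qed

section \<open>Message length\<close>

primrec short_messages :: "nat \<Rightarrow> 'a prog \<Rightarrow> bool" where
  "short_messages b (Finish x) \<longleftrightarrow> True"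
| "short_messages b (Awake out k) \<longleftrightarrow>
     (\<forall>w m. out w = Some m \<longrightarrow> length m \<le> b) \<and> (\<forall>inp. short_messages b (k inp))"
| "short_messages b (Asleep p) \<longleftrightarrow> short_messages b p"

lemma short_messages_bind:
  "short_messages b p \<Longrightarrow> (\<And>x. short_messages b (f x)) \<Longrightarrow> short_messages b (bind_prog p f)"
  by (induction p) auto

lemma short_messages_sleep: "short_messages b (sleep t)"
  unfolding sleep_def by (induction t) auto

lemma short_messages_broadcast: "length m \<le> b \<Longrightarrow> short_messages b (broadcast m)"
  by (simp add: broadcast_def)

lemma length_encode: "length (encode s) = 2"
  by (cases s) auto

lemma short_messages_sleeping_mis_rec: "short_messages 2 (sleeping_mis_rec k X s)"
  by (induction k arbitrary: s)
    (auto simp: Let_def length_encode intro!: short_messages_bind short_messages_sleep short_messages_broadcast)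

text \<open>\<open>short_messages\<close> quantifies over all inputs, reachable or not, and is
  therefore preserved by every round.\<close>

lemma short_messages_config:
  assumes "\<And>v. short_messages b (P v)"
  shows "short_messages b (config E P t v)"
proof (induction t arbitrary: v)
  case 0
  then show ?case using assms by (simp add: config_def)
next
  case (Suc t)
  show ?case using Suc[of v]
    by (auto simp: config_Suc round_step_def split: prog.split)
qed

lemma messages_bounded_mis_programs:
  assumes "2 \<le> b"
  shows "messages_bounded E (mis_programs K X) b"
proof -
  have "length m \<le> 2" if "sent (config E (mis_programs K X) t) u v = Some m" for t u v m
    using that short_messages_config[of 2 "mis_programs K X" E t u] short_messages_sleeping_mis_rec
    by (auto simp: mis_programs_def sleeping_mis_def sent_def split: prog.splits)
  then show ?thesis using assms unfolding messages_bounded_def by fastforce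
qed

subsection \<open>Correctness and complexity\<close>

lemma bind_prog_Finish: "bind_prog p Finish = p"
  by (induction p) auto

context
  fixes V :: "nat set" and E :: "(nat \<times> nat) set" and X :: "nat \<Rightarrow> nat \<Rightarrow> bool" and K :: nat
  assumes graph: "simple_graph V E"
begin

lemma config_mis_programs:
  assumes "v \<in> V"
  shows "config E (mis_programs K X) (call_duration K) v =
      Finish (if v \<in> greedy E {(v, i). X v i} K V then InMIS else NotInMIS)"
    and "awake_count E (mis_programs K X) (call_duration K) v = 3 * calls E {(v, i). X v i} K V v"
proof -
  have "mis_programs K X w = (if w \<in> V then bind_prog (sleeping_mis_rec K (X w) Unknown) Finish
       else (Asleep ^^ call_duration K) (Finish Unknown))" if "w \<in> V" for w
    using that by (simp add: mis_programs_def sleeping_mis_def bind_prog_Finish)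
  from call_result[of E V V v "mis_programs K X" K X "\<lambda>_. Finish" "\<lambda>_. Unknown", OF _ _ _ assms this]
  show "config E (mis_programs K X) (call_duration K) v =
      Finish (if v \<in> greedy E {(v, i). X v i} K V then InMIS else NotInMIS)"
    and "awake_count E (mis_programs K X) (call_duration K) v = 3 * calls E {(v, i). X v i} K V v"
    using graph assms by (simp_all add: simple_graph_def)
qed

lemma finish_rounds_le:
  assumes "v \<in> V"
  shows "finish_rounds E (mis_programs K X) v \<le> call_duration K"
  unfolding finish_rounds_def by (rule Least_le) (use config_mis_programs(1)[OF assms] in blast)

lemma final_output_eq:
  assumes "v \<in> V"
  shows "final_output E (mis_programs K X) v =
    (if v \<in> greedy E {(v, i). X v i} K V then InMIS else NotInMIS)"
proof -
  let ?t = "finish_rounds E (mis_programs K X) v"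
  have "\<exists>x. config E (mis_programs K X) ?t v = Finish x"
    unfolding finish_rounds_def by (rule LeastI_ex[OF node_finishes])
  then obtain x where x: "config E (mis_programs K X) ?t v = Finish x" ..
  \<comment> \<open>The first finished configuration persists until \<open>call_duration K\<close>,
    where the result is known.\<close>
  from finished_stays[OF x, of "call_duration K - ?t"] show ?thesis
    using finish_rounds_le[OF assms] config_mis_programs(1)[OF assms] x
    by (simp add: final_output_def)
qed

lemma awake_rounds_eq:
  assumes "v \<in> V"
  shows "awake_rounds E (mis_programs K X) v = 3 * calls E {(v, i). X v i} K V v"
proof -
  have "t < call_duration K" if "config E (mis_programs K X) t v = Awake out k" for t out k
  proof (rule ccontr)
    assume "\<not> t < call_duration K"
    then have "call_duration K + (t - call_duration K) = t" by simp
    then show False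
      using finished_stays[OF config_mis_programs(1)[OF assms], of "t - call_duration K"] that
      by (simp del: if_split_asm)
  qed
  then have "{t. \<exists>out k. config E (mis_programs K X) t v = Awake out k} =
      {t. t < call_duration K \<and> (\<exists>out k. config E (mis_programs K X) t v = Awake out k)}" by blast
  then show ?thesis
    using config_mis_programs(2)[OF assms] by (simp add: awake_rounds_def awake_count_def)
qed

lemma mis_output_eq: "mis_output V E (mis_programs K X) = greedy E {(v, i). X v i} K V"
  using greedy_subset[of E "{(v, i). X v i}" K V]
  by (auto simp: mis_output_def final_output_eq split: if_splits)

lemma greedy_maximal_independent:
  assumes "inner_edges E (greedy E B K V) = 0"
  shows "maximal_independent_set V E (greedy E B K V)"
proof -
  let ?S = "greedy E B K V"
  have "finite ?S"
    using graph greedy_subset[of E B K V] by (auto simp: simple_graph_def intro: finite_subset)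
  then have ind: "E \<inter> ?S \<times> ?S = {}" using assms by (simp add: inner_edges_def)
  then have "independent_set V E ?S"
    using greedy_subset[of E B K V] by (auto simp: independent_set_def)
  moreover have "S' = ?S" if ind': "independent_set V E S'" and sub: "?S \<subseteq> S'" for S'
  proof (rule ccontr)
    assume "S' \<noteq> ?S"
    then obtain v where v: "v \<in> S'" "v \<notin> ?S" using sub by blast
    then have "v \<in> E `` ?S" using ind' by (intro greedy_dominates) (auto simp: independent_set_def)
    then show False using ind' sub v by (auto simp: independent_set_def)
  qed
  ultimately show ?thesis unfolding maximal_independent_set_def by blast
qed

lemma inner_edges_ge_2:
  assumes "finite S" "inner_edges E S \<noteq> 0"
  shows "inner_edges E S \<ge> 2"
proof -
  obtain u v where uv: "(u, v) \<in> E" "u \<in> S" "v \<in> S"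
    using assms by (auto simp: inner_edges_def card_eq_0_iff)
  then have "(v, u) \<in> E" "u \<noteq> v" using graph by (auto simp: simple_graph_def sym_def irrefl_def)
  then have "{(u, v), (v, u)} \<subseteq> E \<inter> S \<times> S" "card {(u, v), (v, u)} = 2" using uv by auto
  then show ?thesis
    unfolding inner_edges_def using assms(1) by (metis card_mono finite_Int finite_SigmaI)
qed

end

text \<open>Markov's inequality: a failing run leaves a tie, hence at least two ordered edges inside
  the output, which yields the factor 1/2.\<close>

lemma prob_maximal_independent_ge:
  assumes graph: "simple_graph V E"
  shows "measure_pmf.prob (random_bits V K) {X. maximal_independent_set V E (mis_output V E (mis_programs K X))} \<ge>
     1 - avg (V \<times> {1..K}) (\<lambda>B. real (inner_edges E (greedy E B K V))) / 2"
proof -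
  have fin: "finite V" using graph by (simp add: simple_graph_def)
  let ?M = "\<lambda>B. maximal_independent_set V E (mis_output V E (mis_programs K (\<lambda>v i. (v, i) \<in> B)))"
  have le: "1 \<le> of_bool (?M B) + 1/2 * real (inner_edges E (greedy E B K V))" for B
  proof (cases "inner_edges E (greedy E B K V) = 0")
    case True
    have "mis_output V E (mis_programs K (\<lambda>v i. (v, i) \<in> B)) = greedy E B K V"
      by (simp add: mis_output_eq[OF graph])
    then show ?thesis using greedy_maximal_independent[OF graph True] by simp
  next
    case False
    then have "inner_edges E (greedy E B K V) \<ge> 2"
      using fin greedy_subset[of E B K V] by (intro inner_edges_ge_2[OF graph]) (auto intro: finite_subset)
    then show ?thesis by (simp add: field_simps)
  qed
  have "1 = avg (V \<times> {1..K}) (\<lambda>B. 1)" using fin by (simp add: avg_const)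
  also have "\<dots> \<le> avg (V \<times> {1..K}) (\<lambda>B. of_bool (?M B) + 1/2 * real (inner_edges E (greedy E B K V)))"
    by (intro avg_mono le)
  also have "\<dots> = measure_pmf.prob (random_bits V K) {X. maximal_independent_set V E (mis_output V E (mis_programs K X))}
      + 1/2 * avg (V \<times> {1..K}) (\<lambda>B. real (inner_edges E (greedy E B K V)))"
    unfolding avg_add avg_cmult prob_random_bits[OF fin] ..
  finally show ?thesis by simp
qed

section \<open>Numerical estimates for the recursion depth\<close>

lemma recursion_depth_bounds:
  assumes "n \<ge> 1"
  shows "real n ^ 3 \<le> 2 ^ recursion_depth n" "2 ^ recursion_depth n \<le> 2 * real n ^ 3"
    "real (recursion_depth n) \<le> 3 * log 2 (real n) + 1"
proof -
  have "log 2 (real n) \<ge> 0" using assms by simp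
  then have K: "real (recursion_depth n) = \<lceil>3 * log 2 (real n)\<rceil>"
    unfolding recursion_depth_def by (simp add: order_trans[of "-1"])
  then show K': "real (recursion_depth n) \<le> 3 * log 2 (real n) + 1" by linarith
  have n: "2 powr (3 * log 2 (real n)) = real n ^ 3"
    using assms by (simp add: powr_powr[symmetric] mult.commute[of 3] powr_realpow)
  have "2 powr (3 * log 2 (real n)) \<le> 2 powr real (recursion_depth n)"
    using K by (intro powr_mono) linarith+
  then show "real n ^ 3 \<le> 2 ^ recursion_depth n" by (simp add: n powr_realpow)
  have "2 powr real (recursion_depth n) \<le> 2 powr (3 * log 2 (real n) + 1)"
    using K' by (intro powr_mono) auto
  then show "2 ^ recursion_depth n \<le> 2 * real n ^ 3" by (simp add: n powr_realpow powr_add)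
qed

text \<open>The union bound over all edges gives failure probability \<open>1 / (2 n)\<close>, which suffices only for
  small \<open>n\<close>.\<close>

lemma failure_bound:
  fixes e K n :: nat
  assumes n: "n \<ge> 1" and K: "K = recursion_depth n" and e: "e \<le> n ^ 2"
    and a: "a \<le> real e / 2 ^ K" "a \<le> real K * real n / 2 / 2 ^ K + real e / 4 ^ K"
  shows "a / 2 \<le> real n powr - (9/8)"
proof -
  \<comment> \<open>With \<open>real n = y ^ 8\<close> the target becomes \<open>1 / y ^ 9\<close>,
    and integer powers of \<open>y\<close> suffice.\<close>
  define y where "y = real n powr (1/8)"
  have y: "y > 0" using n by (simp add: y_def)
  have ny: "real n = y ^ 8" using n by (simp add: y_def powr_realpow[symmetric] powr_powr)
  have target: "real n powr - (9/8) = 1 / y ^ 9"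
    using n by (simp add: y_def powr_realpow[symmetric] powr_powr powr_minus_divide)
  have e': "real e \<le> real n ^ 2" using e by (metis of_nat_le_iff of_nat_power)
  have 2: "real n ^ 3 \<le> 2 ^ K" using recursion_depth_bounds(1)[OF n] K by simp
  show ?thesis
  proof (cases "y \<le> 2")
    \<comment> \<open>Here \<open>n \<le> 256\<close>. The union bound gives
      \<open>1 / (2 * y ^ 8)\<close>, and \<open>y \<le> 2\<close> turns this into
      \<open>1 / y ^ 9\<close>.\<close>
    case True
    have "a \<le> real n ^ 2 / real n ^ 3"
      using n by (intro order_trans[OF a(1)] frac_le e' 2) auto
    also have "\<dots> = 1 / y ^ 8" using n by (simp add: power2_eq_square power3_eq_cube flip: ny)
    finally have "a / 2 \<le> 1 / (2 * y ^ 8)" by simp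
    also have "\<dots> \<le> 1 / y ^ 9"
      using y True by (intro divide_left_mono) (auto simp: eval_nat_numeral)
    finally show ?thesis using target by simp
  next
    \<comment> \<open>Here the sharper bound is used: the logarithm is at most
      \<open>16 * y\<close>, so \<open>real K \<le> 48 * y + 1\<close>, and
      \<open>12 * y + 1 \<le> 2 ^ 6 * y \<le> y ^ 7\<close> since \<open>y > 2\<close>.\<close>
    case False
    have "log 2 (real n) = 8 * (ln y / ln 2)"
      using y by (simp add: ny log_def ln_realpow)
    also have "\<dots> \<le> 8 * (2 * y)"
    proof -
      have "ln y \<le> y - 1" using y by (rule ln_le_minus_one)
      moreover have "1 \<le> 2 * ln (2::real)" using ln2_ge_two_thirds by simp
      then have "y * 1 \<le> y * (2 * ln 2)" using y by (intro mult_left_mono) auto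
      ultimately have "ln y \<le> 2 * y * ln 2" by simp
      then show ?thesis by (simp add: divide_le_eq)
    qed
    finally have Ky: "real K \<le> 48 * y + 1" using recursion_depth_bounds(3)[OF n] K by simp
    have "a \<le> real K * real n / 2 / real n ^ 3 + real n ^ 2 / (real n ^ 3) ^ 2"
    proof (intro order_trans[OF a(2)] add_mono frac_le e' 2)
      have "(real n ^ 3) ^ 2 \<le> (2 ^ K) ^ 2" using 2 by (intro power_mono) auto
      also have "\<dots> = 4 ^ K" by (simp add: power_mult[symmetric] mult.commute[of K] power_mult)
      finally show "(real n ^ 3) ^ 2 \<le> 4 ^ K" .
    qed (use n in auto)
    also have "\<dots> \<le> (real K / 2 + 1) / real n ^ 2"
    proof -
      have "real n ^ 2 / (real n ^ 3) ^ 2 \<le> 1 / real n ^ 2"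
        using n power_increasing[of 4 6 "real n"]
        by (simp add: divide_simps power_mult[symmetric] flip: power_add)
      moreover have "real K * real n / 2 / real n ^ 3 = real K / 2 / real n ^ 2"
        using n by (simp add: power2_eq_square power3_eq_cube)
      ultimately show ?thesis by (simp add: add_divide_distrib)
    qed
    finally have "a / 2 \<le> (real K / 4 + 1 / 2) / y ^ 16"
      by (simp add: ny power_mult[symmetric] add_divide_distrib)
    also have "\<dots> \<le> (12 * y + 1) / y ^ 16"
      using Ky y by (intro divide_right_mono) auto
    also have "\<dots> \<le> y ^ 7 / y ^ 16"
    proof (intro divide_right_mono)
      have "2 ^ 6 * y \<le> y ^ 6 * y" using False by (intro mult_right_mono power_mono) auto
      also have "y ^ 6 * y = y ^ 7" by (simp add: eval_nat_numeral)
      finally show "12 * y + 1 \<le> y ^ 7" using False by simp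
    qed (use y in auto)
    also have "\<dots> = 1 / y ^ 9" using y by (simp add: divide_simps flip: power_add)
    finally show ?thesis using target by simp
  qed
qed

theorem theorem1:
  shows "\<exists>(C::real) (\<gamma>::real). \<gamma> > 1 \<and>
    (\<forall>V E n K. simple_graph V E \<and> card V = n \<and> n \<ge> 1 \<and> K = recursion_depth n \<longrightarrow>
       (\<forall>X \<in> set_pmf (random_bits V K). messages_bounded E (mis_programs K X) (C * log 2 (real n))) \<and>
       measure_pmf.prob (random_bits V K)
         {X. maximal_independent_set V E (mis_output V E (mis_programs K X))}
         \<ge> 1 - real n powr (- \<gamma>) \<and>
       measure_pmf.expectation (random_bits V K)
         (\<lambda>X. node_average V (awake_rounds E (mis_programs K X))) \<le> C \<and>
       (\<forall>X \<in> set_pmf (random_bits V K).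
          worst_case V (awake_rounds E (mis_programs K X)) \<le> C * log 2 (real n)) \<and>
       (\<forall>X \<in> set_pmf (random_bits V K).
          node_average V (finish_rounds E (mis_programs K X)) \<le> C * real n ^ 3) \<and>
       (\<forall>X \<in> set_pmf (random_bits V K).
          worst_case V (finish_rounds E (mis_programs K X)) \<le> C * real n ^ 3))"
\<comment> \<open>12 is three awake rounds times a mean of at most 4 participations. It also covers
  \<open>3 * K \<le> 9 * log 2 n + 3\<close> for \<open>n \<ge> 2\<close>, two-bit messages, and
  \<open>3 * 2 ^ K \<le> 6 * n ^ 3\<close>. The exponent 9/8 is that of
  \<open>failure_bound\<close>.\<close>
proof (rule exI[of _ 12], rule exI[of _ "9/8"], intro conjI allI impI ballI)
  fix V E n K
  assume asm: "simple_graph V E \<and> card V = n \<and> n \<ge> 1 \<and> K = recursion_depth n"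
  then have graph: "simple_graph V E" and n: "card V = n" "n \<ge> 1" and K: "K = recursion_depth n"
    by auto
  have fin: "finite V" and irr: "irrefl E" and sym: "sym E" and EV: "E \<subseteq> V \<times> V"
    using graph by (auto simp: simple_graph_def)
  have V: "V \<noteq> {}" using n by auto
  have log: "log 2 (real n) \<ge> 1" if "n \<noteq> 1" using that n by (simp add: le_log_iff)
  have finish: "real (finish_rounds E (mis_programs K X) v) \<le> 12 * real n ^ 3" if "v \<in> V" for X v
  proof -
    have "real (finish_rounds E (mis_programs K X) v) \<le> real (call_duration K)"
      using finish_rounds_le[OF graph that] by simp
    also have "\<dots> \<le> 3 * 2 ^ K" by (simp add: call_duration_def of_nat_diff)
    also have "\<dots> \<le> 6 * real n ^ 3" using recursion_depth_bounds(2)[OF n(2)] K by simp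
    also have "\<dots> \<le> 12 * real n ^ 3" by (intro mult_right_mono) auto
    finally show ?thesis .
  qed
  have awake: "real (awake_rounds E (mis_programs K X) v) \<le> 12 * log 2 (real n)" if "v \<in> V" for X v
  proof -
    have "real (awake_rounds E (mis_programs K X) v) \<le> 3 * real K"
      using calls_le[of E "{(v, i). X v i}" K V v] that by (simp add: awake_rounds_eq[OF graph])
    also have "\<dots> \<le> 12 * log 2 (real n)"
    \<comment> \<open>For a single vertex the logarithm is 0, but so is the recursion depth.\<close>
    proof (cases "n = 1")
      case False
      then show ?thesis using recursion_depth_bounds(3)[OF n(2)] log K by linarith
    qed (simp add: K recursion_depth_def)
    finally show ?thesis .
  qed
  {
    fix X
    show "messages_bounded E (mis_programs K X) (12 * log 2 (real n))"
    proof (cases "n = 1")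
      case True
      then obtain v where "V = {v}" using n by (auto simp: card_1_singleton_iff)
      then have "E = {}" using EV irr by (auto simp: irrefl_def)
      then show ?thesis by (simp add: messages_bounded_def)
    qed (use log in \<open>auto intro!: messages_bounded_mis_programs\<close>)
    show "worst_case V (awake_rounds E (mis_programs K X)) \<le> 12 * log 2 (real n)"
    proof -
      have "Max (awake_rounds E (mis_programs K X) ` V) \<in> awake_rounds E (mis_programs K X) ` V"
        using fin V by (intro Max_in) auto
      then show ?thesis using awake by (auto simp: worst_case_def)
    qed
    show "worst_case V (finish_rounds E (mis_programs K X)) \<le> 12 * real n ^ 3"
    proof -
      have "Max (finish_rounds E (mis_programs K X) ` V) \<in> finish_rounds E (mis_programs K X) ` V"
        using fin V by (intro Max_in) auto
      then show ?thesis using finish by (auto simp: worst_case_def)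
    qed
    have "(\<Sum>v\<in>V. real (finish_rounds E (mis_programs K X) v)) \<le> real (card V) * (12 * real n ^ 3)"
      by (rule sum_bounded_above) (rule finish)
    then show "node_average V (finish_rounds E (mis_programs K X)) \<le> 12 * real n ^ 3"
      using n by (simp add: node_average_def divide_le_eq mult.commute)
  }
  show "measure_pmf.expectation (random_bits V K)
      (\<lambda>X. node_average V (awake_rounds E (mis_programs K X))) \<le> 12"
  proof -
    have "measure_pmf.expectation (random_bits V K) (\<lambda>X. node_average V (awake_rounds E (mis_programs K X)))
       = avg (V \<times> {1..K}) (\<lambda>B. 3 / real n * (\<Sum>v\<in>V. real (calls E B K V v)))"
      unfolding expectation_random_bits[OF fin] node_average_def n(1)
      by (intro avg_cong) (simp add: awake_rounds_eq[OF graph] sum_distrib_left[symmetric])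
    also have "\<dots> \<le> 3 / real n * (4 * real n)"
      unfolding avg_cmult using avg_calls_le[OF fin sym irr, of K] n by (intro mult_left_mono) auto
    finally show ?thesis using n by simp
  qed
  show "measure_pmf.prob (random_bits V K)
      {X. maximal_independent_set V E (mis_output V E (mis_programs K X))} \<ge> 1 - real n powr - (9/8)"
  proof -
    have "inner_edges E V \<le> card (V \<times> V)"
      unfolding inner_edges_def using fin by (intro card_mono) auto
    then have "inner_edges E V \<le> n ^ 2"
      using n by (simp add: card_cartesian_product power2_eq_square)
    then have "avg (V \<times> {1..K}) (\<lambda>B. real (inner_edges E (greedy E B K V))) / 2 \<le> real n powr - (9/8)"
      using avg_inner_edges_greedy_le[OF fin sym irr, of K] avg_inner_edges_greedy_le_card[OF fin sym irr, of K] n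
      by (intro failure_bound[OF n(2) K]) auto
    then show ?thesis using prob_maximal_independent_ge[OF graph, of K] by linarith
  qed
qed simp

end
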